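(* Let $V$ be a real vector space, $R:V\to\mathbb{R}\cup\{+\infty\}$ and $f:\mathbb{R}^m\to\mathbb{R}\cup\{+\infty\}$ convex, $\Phi:V\to\mathbb{R}^m$ linear surjective, and $S$ the set of minimizers of $\min_u R(u)+f(\Phi u)$. Assume $p\in S$, $R(p)+f(\Phi p)<+\infty$, and $\mathrm{lev}_R(p)=\{u: R(u)\le R(p)\}$ is linearly closed. Let $K=\mathrm{lin}(\mathrm{lev}_R(p))$, $d=\dim\Phi(K)$, $L=\ker\Phi$, and let $\ell$ be the dimension of the minimal face of $\Phi p$ in $\mathrm{lev}_f(\Phi p)=\{w: f(w)\le f(\Phi p)\}$. If $\dim\big(\pi_{K\cap L}(F(p,S))\big)=j<+\infty$, then $\pi_K(p)$ belongs to a face of $\pi_K(\mathrm{lev}_R(p))$ of dimension at most $k$, where $$k=\begin{cases} m-\ell+j-d-1 & \text{if } R(p)>\inf R \text{ or } f(\Phi p)>\inf f,\\ m-\ell+j-d & \text{otherwise.}\end{cases}$$ In particular, $\pi_K(p)$ can be written either as a convex combination of at most $k+1$ extreme points of $\pi_K(\mathrm{lev}_R(p))$, or as a convex combination of at most $k$ points of $\pi_K(\mathrm{lev}_R(p))$, each an extreme point or a point of an extreme ray of $\pi_K(\mathrm{lev}_R(p))$. If, moreover, $p$ satisfies the double obliqueness condition, $k$ can be replaced by $m-\ell+j-d-2$.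
   Context: For a convex set $C$ in a real vector space: open segment $]x,y[=\{tx+(1-t)y:0<t<1\}$ ($x\ne y$); a face of $C$ is a convex $F\subseteq C$ such that every open segment contained in $C$ intersecting $F$ is contained in $F$; the dimension of a convex set/face is that of its affine hull; $F(x,C)$ is the intersection of all faces of $C$ containing $x$; extreme point: $\{x\}$ is a face; extreme ray: a half-line $\{a+tv:t>0\}$, $v\neq0$, contained in $C$ which is a face. $C$ is linearly closed if its intersection with every line is closed in that line. The lineality space of a nonempty convex $C$ is $\mathrm{lin}(C)=\{v: C+\mathbb{R}v\subseteq C\}$. For a subspace $W\subseteq V$, $\pi_W:V\to V/W$ is the canonical quotient map. Double obliqueness: with $M=R(p)+f(\Phi p)$, $\mathrm{epi}(R)=\{(u,r): R(u)\le r\}\subseteq V\times\mathbb{R}$, $\mathrm{hypo}(M-f)=\{(w,r): M-f(w)\ge r\}\subseteq\mathbb{R}^m\times\mathbb{R}$; for convex $C\subseteq X\times\mathbb{R}$ and $(x,r)\in C$, $F((x,r),C)$ is oblique if its affine hull is not contained in $X\times\{r\}$; $p$ satisfies the double obliqueness condition if $F((p,R(p)),\mathrm{epi}(R))$ and $F((\Phi p,M-f(\Phi p)),\mathrm{hypo}(M-f))$ are both oblique. *)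

theory Defs
  imports "HOL-Analysis.Analysis" "HOL-Library.Extended_Real"
begin

definition epi :: "('a::real_vector \<Rightarrow> ereal) \<Rightarrow> ('a \<times> real) set" where
  "epi g = {(u, r). g u \<le> ereal r}"

definition ext_convex :: "('a::real_vector \<Rightarrow> ereal) \<Rightarrow> bool" where
  "ext_convex g \<longleftrightarrow> (\<forall>u. g u \<noteq> -\<infinity>) \<and> convex (epi g)"

definition pface :: "'a::real_vector set \<Rightarrow> 'a set \<Rightarrow> bool" where
  "pface F C \<longleftrightarrow> convex F \<and> F \<subseteq> C \<and>
     (\<forall>x y. open_segment x y \<subseteq> C \<and> open_segment x y \<inter> F \<noteq> {} \<longrightarrow> open_segment x y \<subseteq> F)"

definition minface :: "'a::real_vector \<Rightarrow> 'a set \<Rightarrow> 'a set" where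
  "minface x C = \<Inter> {F. pface F C \<and> x \<in> F}"

text \<open>Affine dimension of a nonempty set: dimension of the direction space of its affine hull.
  It is meaningful only together with finiteness.\<close>
definition adim_finite :: "'a::real_vector set \<Rightarrow> bool" where
  "adim_finite C \<longleftrightarrow> (\<exists>B. finite B \<and> span B = span {x - y | x y. x \<in> C \<and> y \<in> C})"

definition adim :: "'a::real_vector set \<Rightarrow> nat" where
  "adim C = dim {x - y | x y. x \<in> C \<and> y \<in> C}"

definition extreme_point :: "'a::real_vector \<Rightarrow> 'a set \<Rightarrow> bool" where
  "extreme_point x C \<longleftrightarrow> pface {x} C"

definition extreme_ray :: "'a::real_vector set \<Rightarrow> 'a set \<Rightarrow> bool" where
  "extreme_ray H C \<longleftrightarrow> (\<exists>a v. v \<noteq> 0 \<and> H = {a + t *\<^sub>R v | t. t > 0} \<and> H \<subseteq> C \<and> pface H C)"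

definition linearly_closed :: "'a::real_vector set \<Rightarrow> bool" where
  "linearly_closed C \<longleftrightarrow> (\<forall>a v. closed {t::real. a + t *\<^sub>R v \<in> C})"

definition lineality :: "'a::real_vector set \<Rightarrow> 'a set" where
  "lineality C = {v. \<forall>x\<in>C. \<forall>t::real. x + t *\<^sub>R v \<in> C}"

text \<open>Canonical quotient map by W, represented up to linear isomorphism: any linear surjection
  whose kernel is exactly W.\<close>
definition is_quotient_map :: "('a::real_vector \<Rightarrow> 'b::real_vector) \<Rightarrow> 'a set \<Rightarrow> bool" where
  "is_quotient_map q W \<longleftrightarrow> linear q \<and> surj q \<and> {x. q x = 0} = W"

definition oblique :: "('a::real_vector \<times> real) \<Rightarrow> ('a \<times> real) set \<Rightarrow> bool" where
  "oblique z C \<longleftrightarrow> \<not> (affine hull (minface z C) \<subseteq> {y. snd y = snd z})"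

definition face_bound :: "'a::real_vector \<Rightarrow> 'a set \<Rightarrow> int \<Rightarrow> bool" where
  "face_bound x C k \<longleftrightarrow>
     (\<exists>F. pface F C \<and> x \<in> F \<and> adim_finite F \<and> int (adim F) \<le> k) \<and>
     ((\<exists>X. finite X \<and> int (card X) \<le> k + 1 \<and> (\<forall>y\<in>X. extreme_point y C) \<and> x \<in> convex hull X) \<or>
      (\<exists>X. finite X \<and> int (card X) \<le> k \<and>
         (\<forall>y\<in>X. extreme_point y C \<or> (\<exists>H. extreme_ray H C \<and> y \<in> H)) \<and> x \<in> convex hull X))"

end

theory Submission
  imports Defs
begin

text \<open>
  The directions in which a point \<open>x\<close> of a convex set \<open>C\<close> can be moved both ways inside \<open>C\<close> form
  a subspace, the direction space of the minimal face of \<open>x\<close>; all dimensions are computed with it.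
  Let \<open>D\<close> and \<open>B\<close> be these spaces for \<open>p\<close> in \<open>levR\<close> and \<open>\<Phi> p\<close> in \<open>levf\<close>. Moving along
  \<open>D \<inter> \<Phi>\<^sup>-\<^sup>1 B\<close> stays among the minimizers, so modulo \<open>K \<inter> L\<close> this space has dimension at most
  \<open>j\<close>, and it has codimension at most \<open>dim (\<Phi> D + B) - dim B\<close> in \<open>D\<close>. If \<open>R(p)\<close> or
  \<open>f(\<Phi> p)\<close> is not minimal then \<open>\<Phi> D + B\<close> is a proper subspace, since otherwise a descent direction
  of one function could be corrected to a descent direction of the sum. Under double obliqueness the
  same count is made one dimension higher, for the epigraph of \<open>R\<close> and the hypograph of \<open>M - f\<close>:
  the sum is again proper, and both direction spaces gain one dimension. Finally, Klee's version of
  the Krein-Milman theorem for linearly closed sets without lines, sharpened by a Caratheodory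
  argument that slides points along extreme rays, turns the dimension of the face into the number of
  generators.
\<close>

subsection \<open>Dimension in arbitrary real vector spaces\<close>

text \<open>\<open>dim\<close> falls back to 0 on infinite-dimensional sets; this predicate marks
  the sets on which it can be trusted. Asking only for containment in a finite span makes it
  monotone.\<close>

definition findim :: "'a::real_vector set \<Rightarrow> bool" where
  "findim A \<longleftrightarrow> (\<exists>B. finite B \<and> A \<subseteq> span B)"

lemma findim_mono: "A \<subseteq> B \<Longrightarrow> findim B \<Longrightarrow> findim A"
  unfolding findim_def by blast

lemma findim_span: "findim A \<Longrightarrow> findim (span A)"
  unfolding findim_def by (meson span_minimal subspace_span)

lemma findim_euclidean: "findim (A :: 'a::euclidean_space set)"
  unfolding findim_def by (rule exI[of _ Basis]) simp

lemma findim_basis: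
  assumes "findim A"
  obtains B where "B \<subseteq> A" "finite B" "independent B" "A \<subseteq> span B" "card B = dim A"
proof -
  obtain B where B: "B \<subseteq> A" "independent B" "A \<subseteq> span B" "card B = dim A"
    using basis_exists by blast
  moreover obtain C where "finite C" "A \<subseteq> span C"
    using assms unfolding findim_def by blast
  ultimately have "finite B" using independent_span_bound[of C B] by blast
  with B that show ?thesis by blast
qed

lemma dim_mono_findim:
  assumes "A \<subseteq> span B" "findim B"
  shows "dim A \<le> dim B"
proof -
  obtain C where C: "C \<subseteq> B" "finite C" "B \<subseteq> span C" "card C = dim B"
    using findim_basis[OF assms(2)] by metis
  have "A \<subseteq> span C"
    using assms(1) C(3) by (meson order_trans span_minimal subspace_span)
  then show ?thesis using dim_le_card[OF _ C(2)] C(4) by simp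
qed

lemma findim_image:
  assumes "linear g" "findim A"
  shows "findim (g ` A)"
proof -
  obtain B where B: "finite B" "A \<subseteq> span B"
    using assms(2) unfolding findim_def by blast
  have "g ` A \<subseteq> span (g ` B)"
    using B(2) linear_span_image[OF assms(1), of B] by blast
  with B(1) show ?thesis unfolding findim_def by blast
qed

text \<open>A basis of the kernel is extended to a basis of \<open>A\<close>, and \<open>g\<close>
  maps the added vectors injectively onto a basis of the image. That \<open>A\<close> has finite
  dimension is part of the conclusion.\<close>

lemma rank_nullity_on:
  fixes g :: "'a::real_vector \<Rightarrow> 'b::real_vector"
  assumes lin: "linear g" and A: "subspace A"
    and fi: "findim (g ` A)" and fk: "findim {a \<in> A. g a = 0}"
  shows "findim A \<and> dim A = dim (g ` A) + dim {a \<in> A. g a = 0}"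
proof -
  define N where "N = {a \<in> A. g a = 0}"
  have sN: "subspace N"
    using A linear_0[OF lin] linear_add[OF lin] linear_scale[OF lin]
    unfolding N_def subspace_def by auto
  obtain B0 where B0: "B0 \<subseteq> N" "finite B0" "independent B0" "N \<subseteq> span B0" "card B0 = dim N"
    using findim_basis fk N_def by metis
  have "B0 \<subseteq> A" using B0(1) N_def by auto
  then obtain B where B: "B0 \<subseteq> B" "B \<subseteq> A" "independent B" "A \<subseteq> span B"
    using maximal_independent_subset_extend B0(3) by metis
  \<comment> \<open>\<open>h\<close> kills the kernel of \<open>g\<close> on \<open>A\<close> and
    fixes the added basis vectors, so the kernel meets their span only in 0.\<close>
  obtain h where h: "linear h" "\<And>b. b \<in> B \<Longrightarrow> h b = (if b \<in> B0 then 0 else b)"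
    using linear_independent_extend[OF B(3), of "\<lambda>b. if b \<in> B0 then 0 else b"] by metis
  have h0: "h z = 0" if "z \<in> span B0" for z
    by (rule linear_eq_0_on_span[OF h(1) _ that]) (use h(2) B(1) in auto)
  have h1: "h z = z" if "z \<in> span (B - B0)" for z
    using linear_eq_on_span[OF h(1) linear_id, of "B - B0" z] that h(2) by auto
  have sub: "span (B - B0) \<subseteq> A"
    using span_minimal[OF _ A, of "B - B0"] B(2) by auto
  have inj: "inj_on g (span (B - B0))"
  proof (rule inj_onI)
    fix x y assume xy: "x \<in> span (B - B0)" "y \<in> span (B - B0)" "g x = g y"
    have d: "x - y \<in> span (B - B0)" using xy span_diff by blast
    have "g (x - y) = 0" using xy(3) linear_diff[OF lin] by simp
    then have "x - y \<in> N" using d sub N_def by auto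
    then have "h (x - y) = 0" using h0 B0(4) by blast
    then show "x = y" using h1[OF d] by simp
  qed
  have ind: "independent (g ` (B - B0))"
    by (rule linear_independent_injective_image[OF lin _ inj])
       (use B(3) dependent_mono in blast)
  have sp: "g ` A \<subseteq> span (g ` (B - B0))"
  proof -
    have "g ` B \<subseteq> span (g ` (B - B0))"
    proof
      fix y assume "y \<in> g ` B"
      then obtain b where b: "b \<in> B" "y = g b" by auto
      show "y \<in> span (g ` (B - B0))"
      proof (cases "b \<in> B0")
        case True
        then have "g b = 0" using B0(1) N_def by auto
        then show ?thesis using b span_zero by simp
      next
        case False
        then have "g b \<in> g ` (B - B0)" using b(1) by simp
        then show ?thesis using b(2) span_base by metis
      qed
    qed
    then have "span (g ` B) \<subseteq> span (g ` (B - B0))" by (simp add: span_minimal)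
    then show ?thesis using B(4) linear_span_image[OF lin, of B] by blast
  qed
  have gB: "g ` (B - B0) \<subseteq> g ` A" using B(2) by blast
  have dimI: "card (g ` (B - B0)) = dim (g ` A)"
    by (rule basis_card_eq_dim[OF gB sp ind])
  obtain C where C: "finite C" "g ` A \<subseteq> span C"
    using fi unfolding findim_def by blast
  have "g ` (B - B0) \<subseteq> span C" using gB C(2) by (rule order_trans)
  then have "finite (g ` (B - B0))"
    using independent_span_bound[OF C(1) ind] by blast
  moreover have injB: "inj_on g (B - B0)"
    using inj by (rule inj_on_subset) (simp add: span_superset)
  ultimately have finB: "finite B"
    using B0(2) finite_imageD finite_Diff2 by metis
  have "card B = card (B - B0) + card B0"
    using B(1) finB card_mono[OF finB B(1)] by (simp add: card_Diff_subset B0(2))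
  moreover have "card B = dim A" using basis_card_eq_dim[OF B(2,4,3)] .
  ultimately have "dim A = dim (g ` A) + dim N"
    using dimI B0(5) card_image[OF injB] by simp
  then show ?thesis using finB B(4) unfolding N_def findim_def by blast
qed

lemma dim_zero_subset: "A \<subseteq> {0} \<Longrightarrow> dim A = 0" "A \<subseteq> {0} \<Longrightarrow> findim A"
proof -
  assume A: "A \<subseteq> {0}"
  then have "A \<subseteq> span {}" by simp
  then show "dim A = 0" using dim_le_card[of A "{}"] by simp
  show "findim A" unfolding findim_def using \<open>A \<subseteq> span {}\<close> by blast
qed

lemma dim_image_injective:
  assumes "linear g" "subspace A" "findim (g ` A)" "\<And>a. a \<in> A \<Longrightarrow> g a = 0 \<Longrightarrow> a = 0"
  shows "findim A" "dim A = dim (g ` A)"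
proof -
  have *: "{a \<in> A. g a = 0} \<subseteq> {0}" using assms(4) by auto
  show "findim A" "dim A = dim (g ` A)"
    using rank_nullity_on[OF assms(1-3)] dim_zero_subset[OF *] by auto
qed

text \<open>Rank-nullity for \<open>(a, b) \<mapsto> g a + b\<close> on \<open>A \<times> B\<close>, whose kernel is a copy of the preimage of \<open>B\<close>.\<close>

lemma dim_preimage_bound:
  fixes g :: "'a::real_vector \<Rightarrow> 'e::euclidean_space"
  assumes lin: "linear g" and A: "subspace A" and B: "subspace B"
    and W: "B \<subseteq> W" "g ` A \<subseteq> W" "subspace W"
    and f2: "findim {a \<in> A. g a \<in> B}"
  shows "findim A \<and> dim A + dim B \<le> dim {a \<in> A. g a \<in> B} + dim W"
proof -
  define T where "T = (\<lambda>x::'a \<times> 'e. g (fst x) + snd x)"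
  define N where "N = {x \<in> A \<times> B. T x = 0}"
  have linT: "linear T"
    unfolding T_def
    by (intro linear_compose_add linear_compose[unfolded o_def, OF linear_fst lin] linear_snd)
  have sAB: "subspace (A \<times> B)" using A B by (rule subspace_Times)
  have sN: "subspace N"
    using sAB linear_0[OF linT] linear_add[OF linT] linear_scale[OF linT]
    unfolding N_def subspace_def by auto
  have im: "fst ` N = {a \<in> A. g a \<in> B}"
  proof
    show "fst ` N \<subseteq> {a \<in> A. g a \<in> B}"
      using subspace_neg[OF B] by (force simp: N_def T_def add_eq_0_iff)
    show "{a \<in> A. g a \<in> B} \<subseteq> fst ` N"
    proof
      fix a assume "a \<in> {a \<in> A. g a \<in> B}"
      then have "(a, - g a) \<in> N" using subspace_neg[OF B] by (auto simp: N_def T_def)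
      then show "a \<in> fst ` N" by force
    qed
  qed
  have kN: "x = 0" if "x \<in> N" "fst x = 0" for x
  proof -
    have "snd x = 0" using that linear_0[OF lin] by (simp add: N_def T_def)
    with that(2) show ?thesis by (simp add: prod_eq_iff)
  qed
  have N: "findim N" "dim N = dim {a \<in> A. g a \<in> B}"
    using dim_image_injective[OF linear_fst sN] f2 im kN by simp_all
  have AB: "findim (A \<times> B)" "dim (A \<times> B) = dim (T ` (A \<times> B)) + dim N"
    using rank_nullity_on[OF linT sAB findim_euclidean] N(1) unfolding N_def by auto
  have TW: "T ` (A \<times> B) \<subseteq> W"
    using W(1,2) by (auto simp: T_def intro!: subspace_add[OF W(3)])
  have fstAB: "fst ` (A \<times> B) = A" using subspace_0[OF B] by force
  have fA: "findim A" using findim_image[OF linear_fst AB(1)] fstAB by simp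
  \<comment> \<open>\<open>M\<close>, the kernel of the first projection, is a copy of
    \<open>B\<close>; this turns the dimension of \<open>A \<times> B\<close> into a sum.\<close>
  define M where "M = {x \<in> A \<times> B. fst x = 0}"
  have sM: "subspace M"
    using sAB unfolding M_def subspace_def by auto
  have fM: "findim M" by (rule findim_mono[OF _ AB(1)]) (auto simp: M_def)
  have sndM: "snd ` M = B" using subspace_0[OF A] by (force simp: M_def)
  have "dim M = dim B"
    using dim_image_injective(2)[OF linear_snd sM findim_euclidean] sndM
    by (auto simp: M_def prod_eq_iff)
  moreover have "dim (A \<times> B) = dim A + dim M"
    using rank_nullity_on[OF linear_fst sAB] fA fM fstAB unfolding M_def by auto
  moreover have "dim (T ` (A \<times> B)) \<le> dim W" by (rule dim_subset[OF TW])
  ultimately show ?thesis using fA AB(2) N(2) by simp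
qed

lemma dim_proper_subspace:
  fixes W :: "'e::euclidean_space set"
  assumes "subspace W" "x \<notin> W"
  shows "dim W + 1 \<le> DIM('e)"
proof -
  have "dim W \<noteq> DIM('e)" using assms dim_eq_full span_eq_iff by (metis UNIV_I)
  then show ?thesis using dim_subset_UNIV[of W] by simp
qed

subsection \<open>Face directions\<close>

lemma dim_strict_mono:
  assumes "subspace A" "A \<subseteq> B" "v \<in> B" "v \<notin> A" "findim B"
  shows "dim A < dim B"
proof -
  obtain C where C: "C \<subseteq> A" "finite C" "independent C" "A \<subseteq> span C" "card C = dim A"
    using findim_basis[OF findim_mono[OF assms(2,5)]] by metis
  obtain C' where C': "finite C'" "B \<subseteq> span C'" "card C' = dim B"
    using findim_basis[OF assms(5)] by metis
  have "span C = A" using C assms(1) by (simp add: span_subspace)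
  then have v: "v \<notin> span C" using assms(4) by simp
  then have "independent (insert v C)" using C(3) independent_insert by metis
  moreover have "insert v C \<subseteq> span C'" using C(1) C'(2) assms(2,3) by blast
  ultimately have "card (insert v C) \<le> card C'"
    using independent_span_bound[OF C'(1)] by blast
  moreover have "v \<notin> C" using v span_base by metis
  ultimately show ?thesis using C C'(3) by simp
qed

text \<open>Two opposite points suffice, since convexity fills the segment between them. Working
  with this set keeps affine hulls of minimal faces out of the dimension counts.\<close>

definition facedir :: "'a::real_vector \<Rightarrow> 'a set \<Rightarrow> 'a set" where
  "facedir x C = {v. \<exists>e>0. x + e *\<^sub>R v \<in> C \<and> x - e *\<^sub>R v \<in> C}"

lemma convex_combination:
  assumes "convex C" "a \<in> C" "b \<in> C" "0 \<le> u" "u \<le> 1"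
  shows "(1 - u) *\<^sub>R a + u *\<^sub>R b \<in> C"
  using convexD[OF assms(1-3), of "1 - u" u] assms(4,5) by simp

lemma facedir_segment:
  assumes "convex C" "v \<in> facedir x C"
  obtains e where "e > 0" "\<And>t. \<bar>t\<bar> \<le> e \<Longrightarrow> x + t *\<^sub>R v \<in> C"
proof -
  obtain e where e: "e > 0" "x + e *\<^sub>R v \<in> C" "x - e *\<^sub>R v \<in> C"
    using assms(2) unfolding facedir_def by blast
  have "x + t *\<^sub>R v \<in> C" if "\<bar>t\<bar> \<le> e" for t
  proof -
    \<comment> \<open>The relative position of \<open>x + t v\<close> on the segment from
      \<open>x - e v\<close> to \<open>x + e v\<close>.\<close>
    define u where "u = (t + e) / (2 * e)"
    have u: "0 \<le> u" "u \<le> 1" "t = u * e - (1 - u) * e"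
      using that e(1) by (auto simp: u_def field_simps)
    have "(1 - u) *\<^sub>R (x - e *\<^sub>R v) + u *\<^sub>R (x + e *\<^sub>R v) =
        ((1 - u) + u) *\<^sub>R x + (u * e - (1 - u) * e) *\<^sub>R v"
      by (simp only: scaleR_add_left scaleR_diff_left scaleR_add_right scaleR_diff_right scaleR_scaleR)
         (simp add: algebra_simps)
    also have "\<dots> = x + t *\<^sub>R v" using u(3) by simp
    finally show ?thesis using convex_combination[OF assms(1) e(3,2) u(1,2)] by simp
  qed
  with e(1) that show ?thesis by blast
qed

lemma facedir_in: "convex C \<Longrightarrow> v \<in> facedir x C \<Longrightarrow> x \<in> C"
  using facedir_segment[of C v x] by (metis abs_zero add.right_neutral less_imp_le scaleR_zero_left)

lemma facedirI: "e > 0 \<Longrightarrow> x + e *\<^sub>R v \<in> C \<Longrightarrow> x - e *\<^sub>R v \<in> C \<Longrightarrow> v \<in> facedir x C"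
  unfolding facedir_def by blast

lemma subspace_facedir:
  assumes "convex C" "x \<in> C"
  shows "subspace (facedir x C)"
  unfolding subspace_def
proof (intro conjI ballI allI)
  show "0 \<in> facedir x C" using assms(2) by (auto intro: facedirI[of 1])
next
  fix u v assume "u \<in> facedir x C" "v \<in> facedir x C"
  then obtain d e where d: "d > 0" "\<And>t. \<bar>t\<bar> \<le> d \<Longrightarrow> x + t *\<^sub>R u \<in> C"
    and e: "e > 0" "\<And>t. \<bar>t\<bar> \<le> e \<Longrightarrow> x + t *\<^sub>R v \<in> C"
    using facedir_segment[OF assms(1)] by metis
  define m where "m = min d e"
  have m: "m > 0" "\<bar>m\<bar> \<le> d" "\<bar>m\<bar> \<le> e" "\<bar>-m\<bar> \<le> d" "\<bar>-m\<bar> \<le> e" using d(1) e(1) by (auto simp: m_def)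
  \<comment> \<open>The midpoint of a step along \<open>u\<close> and an equal step along
    \<open>v\<close>.\<close>
  have "x + (t/2) *\<^sub>R (u + v) \<in> C" if "\<bar>t\<bar> \<le> d" "\<bar>t\<bar> \<le> e" for t
  proof -
    have "(1 - 1/2) *\<^sub>R (x + t *\<^sub>R u) + (1/2) *\<^sub>R (x + t *\<^sub>R v) =
        (1/2 + 1/2) *\<^sub>R x + (t/2) *\<^sub>R (u + v)"
      unfolding scaleR_add_left by (simp add: scaleR_add_right)
    then show ?thesis
      using convex_combination[OF assms(1) d(2)[OF that(1)] e(2)[OF that(2)], of "1/2"] by simp
  qed
  from this[of m] this[of "-m"] show "u + v \<in> facedir x C"
    using m by (intro facedirI[of "m/2"]) auto
next
  fix c :: real and v assume "v \<in> facedir x C"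
  then obtain e where e: "e > 0" "\<And>t. \<bar>t\<bar> \<le> e \<Longrightarrow> x + t *\<^sub>R v \<in> C"
    using facedir_segment[OF assms(1)] by metis
  \<comment> \<open>The summand 1 keeps the denominator positive when \<open>c = 0\<close>.\<close>
  define m where "m = e / (\<bar>c\<bar> + 1)"
  have "m > 0" using e(1) by (simp add: m_def)
  moreover have "\<bar>m * c\<bar> \<le> e" using e(1) by (simp add: m_def abs_mult field_simps)
  ultimately show "c *\<^sub>R v \<in> facedir x C"
    using e(2)[of "m * c"] e(2)[of "- (m * c)"] by (intro facedirI[of m]) auto
qed

text \<open>\<open>x\<close> lies between \<open>y\<close> and some point
  \<open>x - e (y - x)\<close> of \<open>C\<close>. The homothety centred at that point which
  carries \<open>y\<close> to \<open>x\<close> has ratio \<open>e / (1 + e)\<close> and shrinks a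
  segment around \<open>y\<close> to one around \<open>x\<close>.\<close>

lemma facedir_subset:
  assumes C: "convex C" and y: "y \<in> C" "y - x \<in> facedir x C"
  shows "facedir y C \<subseteq> facedir x C"
proof
  fix v assume "v \<in> facedir y C"
  then obtain d where d: "d > 0" "y + d *\<^sub>R v \<in> C" "y - d *\<^sub>R v \<in> C"
    unfolding facedir_def by blast
  obtain e where e: "e > 0" "x - e *\<^sub>R (y - x) \<in> C"
    using y(2) unfolding facedir_def by blast
  define u where "u = e / (1 + e)"
  have u: "0 < u" "u \<le> 1" "(1 - u) * e = u" using e(1) by (auto simp: u_def field_simps)
  have eq: "(1 - u) *\<^sub>R (x - e *\<^sub>R (y - x)) + u *\<^sub>R (y + s *\<^sub>R v) = x + (u * s) *\<^sub>R v" for s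
  proof -
    have "(1 - u) *\<^sub>R (x - e *\<^sub>R (y - x)) = (1 - u) *\<^sub>R x - ((1 - u) * e) *\<^sub>R (y - x)"
      by (simp only: scaleR_diff_right scaleR_scaleR)
    also have "\<dots> = (1 - u) *\<^sub>R x - u *\<^sub>R (y - x)" by (simp only: u(3))
    finally show ?thesis by (simp add: algebra_simps)
  qed
  have "x + (u * d) *\<^sub>R v \<in> C"
    using convex_combination[OF C e(2) d(2), of u] u(1,2) unfolding eq by simp
  moreover have "x - (u * d) *\<^sub>R v \<in> C"
    using convex_combination[OF C e(2), of "y + (- d) *\<^sub>R v" u] d(3) u(1,2) unfolding eq by simp
  ultimately show "v \<in> facedir x C" using u(1) d(1) by (intro facedirI[of "u * d"]) auto
qed

lemma open_segment_facedir:
  assumes "open_segment a b \<subseteq> C" "y \<in> open_segment a b"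
  shows "b - a \<in> facedir y C"
proof -
  obtain u where u: "0 < u" "u < 1" "y = (1 - u) *\<^sub>R a + u *\<^sub>R b" and ab: "a \<noteq> b"
    using assms(2) by (auto simp: in_segment)
  define d where "d = min u (1 - u) / 2"
  have d: "0 < d" "d < u" "d < 1 - u" using u by (auto simp: d_def min_def)
  have "y + s *\<^sub>R (b - a) \<in> C" if "0 < u + s" "u + s < 1" for s
  proof -
    have "y + s *\<^sub>R (b - a) = (1 - (u + s)) *\<^sub>R a + (u + s) *\<^sub>R b"
      unfolding u(3) by (simp add: algebra_simps)
    then have "y + s *\<^sub>R (b - a) \<in> open_segment a b"
      using that ab by (auto simp: in_segment)
    then show ?thesis using assms(1) by blast
  qed
  from this[of d] this[of "-d"] show ?thesis using d u by (intro facedirI[of d]) auto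
qed

lemma open_segment_diff:
  assumes "y \<in> open_segment a b" "z \<in> open_segment a b"
  obtains r where "z = y + r *\<^sub>R (b - a)"
proof -
  obtain u w where uw: "y = (1 - u) *\<^sub>R a + u *\<^sub>R b" "z = (1 - w) *\<^sub>R a + w *\<^sub>R b"
    using assms by (auto simp: in_segment)
  have "z = y + (w - u) *\<^sub>R (b - a)" unfolding uw by (simp add: algebra_simps)
  then show ?thesis by (rule that)
qed

text \<open>A segment of \<open>C\<close> that meets this set in \<open>y\<close> has its direction
  in \<open>facedir y C\<close>, hence in \<open>facedir x C\<close>, so it cannot leave the
  set.\<close>

lemma pface_facedir:
  assumes C: "convex C" and x: "x \<in> C"
  shows "pface {y \<in> C. y - x \<in> facedir x C} C"
  unfolding pface_def
proof (intro conjI allI impI)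
  note sub = subspace_facedir[OF C x]
  show "convex {y \<in> C. y - x \<in> facedir x C}"
  proof (rule convexI)
    fix a b and u v :: real
    assume *: "a \<in> {y \<in> C. y - x \<in> facedir x C}" "b \<in> {y \<in> C. y - x \<in> facedir x C}"
      "0 \<le> u" "0 \<le> v" "u + v = 1"
    have "u *\<^sub>R a + v *\<^sub>R b - x = u *\<^sub>R a + v *\<^sub>R b - (u + v) *\<^sub>R x" using *(5) by simp
    also have "\<dots> = u *\<^sub>R (a - x) + v *\<^sub>R (b - x)" by (simp add: algebra_simps)
    finally have "u *\<^sub>R a + v *\<^sub>R b - x \<in> facedir x C"
      using * sub by (simp add: subspace_add subspace_scale)
    then show "u *\<^sub>R a + v *\<^sub>R b \<in> {y \<in> C. y - x \<in> facedir x C}"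
      using * convexD[OF C] by auto
  qed
  show "{y \<in> C. y - x \<in> facedir x C} \<subseteq> C" by auto
  fix a b
  assume *: "open_segment a b \<subseteq> C \<and> open_segment a b \<inter> {y \<in> C. y - x \<in> facedir x C} \<noteq> {}"
  then obtain y where y: "y \<in> open_segment a b" "y \<in> C" "y - x \<in> facedir x C" by blast
  have ba: "b - a \<in> facedir x C"
    using open_segment_facedir[of a b C y] * y(1) facedir_subset[OF C y(2,3)] by blast
  show "open_segment a b \<subseteq> {y \<in> C. y - x \<in> facedir x C}"
  proof
    fix z assume z: "z \<in> open_segment a b"
    obtain r where "z = y + r *\<^sub>R (b - a)" using open_segment_diff[OF y(1) z] .
    then have "z - x = (y - x) + r *\<^sub>R (b - a)" by simp
    also have "\<dots> \<in> facedir x C"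
      by (rule subspace_add[OF sub y(3) subspace_scale[OF sub ba]])
    finally have "z - x \<in> facedir x C" .
    then show "z \<in> {y \<in> C. y - x \<in> facedir x C}" using z * by blast
  qed
qed

lemma minface_facedir:
  assumes "convex C" "x \<in> C" "y \<in> minface x C"
  shows "y - x \<in> facedir x C"
proof -
  have "x \<in> {y \<in> C. y - x \<in> facedir x C}"
    using assms(2) subspace_0[OF subspace_facedir[OF assms(1,2)]] by simp
  then show ?thesis using pface_facedir[OF assms(1,2)] assms(3) unfolding minface_def by blast
qed

lemma self_in_minface: "x \<in> minface x C"
  unfolding minface_def by blast

text \<open>The counterpart of \<open>minface_facedir\<close>: every face through \<open>x\<close>
  absorbs the open segment centred at \<open>x\<close>. Half a step is taken because the endpoints
  are not in the open segment.\<close>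

lemma half_step_in_minface:
  assumes "open_segment (x - w) (x + w) \<subseteq> C"
  shows "x + (1/2) *\<^sub>R w \<in> minface x C"
proof (cases "w = 0")
  case True then show ?thesis by (simp add: self_in_minface)
next
  case False
  have ne: "x - w \<noteq> x + w"
  proof
    assume "x - w = x + w"
    then have "2 *\<^sub>R w = 0" by (simp add: algebra_simps scaleR_2)
    then show False using False by simp
  qed
  have seg: "x + s *\<^sub>R w \<in> open_segment (x - w) (x + w)" if "-1 < s" "s < 1" for s
  proof -
    have "(1 - u) *\<^sub>R (x - w) + u *\<^sub>R (x + w) = x + (2 * u - 1) *\<^sub>R w" for u
      by (simp add: algebra_simps flip: scaleR_2)
    from this[of "(s + 1)/2"]
    have "x + s *\<^sub>R w = (1 - (s + 1)/2) *\<^sub>R (x - w) + ((s + 1)/2) *\<^sub>R (x + w)"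
      by (simp add: field_simps)
    moreover have "0 < (s + 1)/2" "(s + 1)/2 < 1" using that by auto
    ultimately show ?thesis using ne unfolding in_segment by blast
  qed
  have "x \<in> open_segment (x - w) (x + w)" using seg[of 0] by simp
  then have "open_segment (x - w) (x + w) \<subseteq> F" if "pface F C" "x \<in> F" for F
    using that assms unfolding pface_def by blast
  then show ?thesis using seg[of "1/2"] unfolding minface_def by auto
qed

lemma extreme_point_facedir:
  assumes "convex C" "x \<in> C" "facedir x C \<subseteq> {0}"
  shows "extreme_point x C"
proof -
  have "{y \<in> C. y - x \<in> facedir x C} = {x}"
    using assms(2,3) subspace_0[OF subspace_facedir[OF assms(1,2)]] by auto
  then show ?thesis using pface_facedir[OF assms(1,2)] unfolding extreme_point_def by simp
qed

text \<open>Linear closedness puts the last point of the ray into \<open>C\<close>. There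
  \<open>v\<close> is no longer a two-sided direction and no new direction appears, so the dimension
  of the face drops; this drives the induction in \<open>klee_hull\<close>.\<close>

lemma exit_point:
  assumes C: "convex C" "linearly_closed C" and fd: "findim (facedir x C)"
    and v: "v \<in> facedir x C" and ex: "\<not> (\<forall>t\<ge>0. x + t *\<^sub>R v \<in> C)"
  obtains t where "t > 0" "x + t *\<^sub>R v \<in> C" "\<And>s. s > t \<Longrightarrow> x + s *\<^sub>R v \<notin> C"
    "facedir (x + t *\<^sub>R v) C \<subseteq> facedir x C" "v \<notin> facedir (x + t *\<^sub>R v) C"
    "dim (facedir (x + t *\<^sub>R v) C) < dim (facedir x C)"
proof -
  have x: "x \<in> C" using facedir_in[OF C(1) v] .
  obtain t1 where t1: "t1 \<ge> 0" "x + t1 *\<^sub>R v \<notin> C" using ex by blast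
  define T where "T = {t. x + t *\<^sub>R v \<in> C}"
  have clT: "closed T" using C(2) unfolding linearly_closed_def T_def by blast
  \<comment> \<open>A point of \<open>C\<close> beyond \<open>t1\<close> would, by convexity with
    \<open>x\<close>, force the point at \<open>t1\<close> into \<open>C\<close>.\<close>
  have below: "s < t1" if "s \<in> T" for s
  proof (rule ccontr)
    assume "\<not> s < t1"
    then have s: "t1 \<le> s" by simp
    have "s > 0" using t1 s that x by (cases "s = 0") (auto simp: T_def)
    then have "(1 - t1/s) *\<^sub>R x + (t1/s) *\<^sub>R (x + s *\<^sub>R v) = x + t1 *\<^sub>R v"
      by (simp add: algebra_simps)
    moreover have "(1 - t1/s) *\<^sub>R x + (t1/s) *\<^sub>R (x + s *\<^sub>R v) \<in> C"
      using that s t1(1) \<open>s > 0\<close> by (intro convex_combination[OF C(1) x]) (auto simp: T_def)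
    ultimately show False using t1(2) by simp
  qed
  have "compact (T \<inter> {0..t1})" using clT by (simp add: closed_Int_compact)
  moreover have "0 \<in> T \<inter> {0..t1}" using x t1 by (simp add: T_def)
  ultimately obtain t where t: "t \<in> T \<inter> {0..t1}" "\<And>s. s \<in> T \<inter> {0..t1} \<Longrightarrow> s \<le> t"
    using compact_attains_sup[of "T \<inter> {0..t1}"] by blast
  have max: "s \<le> t" if "s \<in> T" for s
    using t(1) t(2)[of s] below[OF that] that by (cases "s \<ge> 0") auto
  obtain e where e: "e > 0" "x + e *\<^sub>R v \<in> C" using v unfolding facedir_def by blast
  have tpos: "t > 0" using max[of e] e by (simp add: T_def)
  let ?y = "x + t *\<^sub>R v"
  have y: "?y \<in> C" using t(1) by (simp add: T_def)
  have yx: "?y - x \<in> facedir x C"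
    using subspace_scale[OF subspace_facedir[OF C(1) x] v] by simp
  have sub: "facedir ?y C \<subseteq> facedir x C" by (rule facedir_subset[OF C(1) y yx])
  have nv: "v \<notin> facedir ?y C"
  proof
    assume "v \<in> facedir ?y C"
    then obtain d where d: "d > 0" "?y + d *\<^sub>R v \<in> C" unfolding facedir_def by blast
    have "t + d \<in> T" using d(2) by (simp add: T_def algebra_simps)
    then show False using max[of "t + d"] d(1) by simp
  qed
  have "dim (facedir ?y C) < dim (facedir x C)"
    by (rule dim_strict_mono[OF subspace_facedir[OF C(1) y] sub v nv fd])
  moreover have "x + s *\<^sub>R v \<notin> C" if "s > t" for s using max[of s] that by (auto simp: T_def)
  ultimately show ?thesis using that[OF tpos y _ sub nv] by blast
qed

text \<open>The ray is required to start at an extreme point of \<open>C\<close>: that endpoint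
  serves as an additional generator when a convex combination is shortened.\<close>

definition ray_point :: "'a::real_vector \<Rightarrow> 'a set \<Rightarrow> bool" where
  "ray_point y C \<longleftrightarrow> (\<exists>a v t. extreme_point a C \<and> v \<noteq> 0 \<and> pface {a + t *\<^sub>R v | t. t > 0} C \<and>
     t > 0 \<and> y = a + t *\<^sub>R v)"

text \<open>Generators are taken inside the minimal face of \<open>x\<close>, so that affine
  dependences among them are governed by \<open>dim (facedir x C)\<close>.\<close>

definition face_generators :: "'a::real_vector \<Rightarrow> 'a set \<Rightarrow> 'a set" where
  "face_generators x C =
     {y \<in> C. y - x \<in> facedir x C \<and> (extreme_point y C \<or> ray_point y C)}"

lemma face_generators_mono:
  assumes "convex C" "x \<in> C" "y \<in> C" "y - x \<in> facedir x C"
  shows "face_generators y C \<subseteq> face_generators x C"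
proof -
  have "w - x \<in> facedir x C" if "w - y \<in> facedir y C" for w
    using subspace_add[OF subspace_facedir[OF assms(1,2)] subsetD[OF facedir_subset[OF assms(1,3,4)] that] assms(4)]
    by simp
  then show ?thesis unfolding face_generators_def by blast
qed

text \<open>The minimal face of \<open>x\<close> lies on a line and is unbounded on one side only.
  The exit point \<open>a\<close> on the other side has lost the only direction there was, so it is
  extreme, and the half-line from \<open>a\<close> is the required face.\<close>

lemma line_ray_point:
  assumes C: "convex C" "linearly_closed C" and x: "x \<in> C" and D: "facedir x C = span {v}"
    and v: "v \<noteq> 0" and rec: "\<forall>t\<ge>0. x + t *\<^sub>R v \<in> C" and nrec: "\<not> (\<forall>t\<ge>0. x - t *\<^sub>R v \<in> C)"
  shows "ray_point x C"
proof -
  have fd: "findim (facedir x C)" unfolding D findim_def by blast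
  have vD: "- v \<in> facedir x C" "v \<in> facedir x C" unfolding D by (simp_all add: span_base span_neg)
  obtain t0 where t0: "t0 > 0" "x + t0 *\<^sub>R (- v) \<in> C" "\<And>s. s > t0 \<Longrightarrow> x + s *\<^sub>R (- v) \<notin> C"
    "facedir (x + t0 *\<^sub>R (- v)) C \<subseteq> facedir x C" "- v \<notin> facedir (x + t0 *\<^sub>R (- v)) C"
    by (rule exit_point[OF C fd vD(1)]) (use nrec in auto)
  define a where "a = x - t0 *\<^sub>R v"
  have a: "a \<in> C" "facedir a C \<subseteq> span {v}" "- v \<notin> facedir a C"
    using t0 D by (simp_all add: a_def)
  have neg: "0 \<le> s" if "a + s *\<^sub>R v \<in> C" for s
    using t0(3)[of "t0 - s"] that by (force simp: a_def algebra_simps)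
  have "facedir a C \<subseteq> {0}"
  proof
    fix w assume w: "w \<in> facedir a C"
    then obtain c where c: "w = c *\<^sub>R v" using a(2) by (auto simp: span_singleton)
    show "w \<in> {0}"
    proof (rule ccontr)
      assume "w \<notin> {0}"
      then have "(- 1 / c) *\<^sub>R w = - v" using c by auto
      then show False
        using subspace_scale[OF subspace_facedir[OF C(1) a(1)] w, of "- 1 / c"] a(3) by simp
    qed
  qed
  then have ea: "extreme_point a C" by (rule extreme_point_facedir[OF C(1) a(1)])
  let ?H = "{a + t *\<^sub>R v | t. t > 0}"
  have inC: "a + t *\<^sub>R v \<in> C" if "t > 0" for t
  proof (cases "t \<ge> t0")
    case True
    then have "x + (t - t0) *\<^sub>R v \<in> C" using rec by simp
    then show ?thesis by (simp add: a_def algebra_simps)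
  next
    case False
    have "(1 - t/t0) *\<^sub>R a + (t/t0) *\<^sub>R x \<in> C"
      using False that by (intro convex_combination[OF C(1) a(1) x]) auto
    moreover have "(1 - t/t0) *\<^sub>R a + (t/t0) *\<^sub>R x = a + t *\<^sub>R v"
      using t0(1) by (simp add: a_def algebra_simps)
    ultimately show ?thesis by simp
  qed
  have hD: "facedir h C \<subseteq> span {v}" if "h \<in> C" "h = a + t *\<^sub>R v" for h t
  proof -
    have "h - x = (t - t0) *\<^sub>R v" using that(2) by (simp add: a_def algebra_simps)
    then have "h - x \<in> facedir x C"
      using subspace_scale[OF subspace_facedir[OF C(1) x] vD(2)] by simp
    then show ?thesis using facedir_subset[OF C(1) that(1)] D by metis
  qed
  have "pface ?H C"
    unfolding pface_def
  proof (intro conjI allI impI)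
    show "convex ?H"
    proof (rule convexI)
      fix y z and u w :: real
      assume *: "y \<in> ?H" "z \<in> ?H" "0 \<le> u" "0 \<le> w" "u + w = 1"
      then obtain s t where st: "s > 0" "t > 0" "y = a + s *\<^sub>R v" "z = a + t *\<^sub>R v" by blast
      have "u *\<^sub>R y + w *\<^sub>R z = (u + w) *\<^sub>R a + (u * s + w * t) *\<^sub>R v"
        unfolding st by (simp add: algebra_simps)
      moreover have "u * s + w * t > 0"
        using * st(1,2) by (cases "u = 0") (auto intro: add_pos_nonneg)
      ultimately show "u *\<^sub>R y + w *\<^sub>R z \<in> ?H" using *(5) by auto
    qed
    show "?H \<subseteq> C" using inC by blast
    fix b c assume *: "open_segment b c \<subseteq> C \<and> open_segment b c \<inter> ?H \<noteq> {}"
    then obtain t where t: "t > 0" "a + t *\<^sub>R v \<in> open_segment b c" by blast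
    have "c - b \<in> span {v}"
      using open_segment_facedir[of b c C, OF _ t(2)] * hD[OF inC[OF t(1)] refl] by blast
    then obtain k where k: "c - b = k *\<^sub>R v" by (auto simp: span_singleton)
    have "b \<noteq> c" using t(2) by auto
    then have k0: "k \<noteq> 0" using k by auto
    show "open_segment b c \<subseteq> ?H"
    proof
      fix z assume z: "z \<in> open_segment b c"
      obtain r where "z = a + t *\<^sub>R v + r *\<^sub>R (c - b)" using open_segment_diff[OF t(2) z] .
      then have zt: "z = a + (t + r * k) *\<^sub>R v" unfolding k by (simp add: algebra_simps)
      \<comment> \<open>\<open>z\<close> has points of \<open>C\<close> on both sides along the
        line. Their parameters are nonnegative and distinct, so the parameter of \<open>z\<close>,
        their mean, is strictly positive.\<close>
      have "c - b \<in> facedir z C" using open_segment_facedir[of b c C, OF _ z] * by blast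
      then obtain e where e: "e > 0" "z + e *\<^sub>R (c - b) \<in> C" "z - e *\<^sub>R (c - b) \<in> C"
        unfolding facedir_def by blast
      have "0 \<le> t + r * k + e * k" "0 \<le> t + r * k - e * k"
        using e(2,3) neg[of "t + r * k + e * k"] neg[of "t + r * k - e * k"]
        unfolding k zt by (simp_all add: scaleR_add_left scaleR_diff_left add.assoc add_diff_eq)
      moreover have "e * k \<noteq> 0" using e(1) k0 by simp
      ultimately have "t + r * k > 0" by linarith
      then show "z \<in> ?H" using zt by blast
    qed
  qed
  moreover have "x = a + t0 *\<^sub>R v" by (simp add: a_def)
  ultimately show ?thesis unfolding ray_point_def using ea v t0(1) by blast
qed

subsection \<open>Generation by extreme points and extreme rays\<close>

text \<open>
  Otherwise the recession directions and their negatives would disconnect the segment from \<open>v\<close> to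
  \<open>- w\<close>.
\<close>

lemma bounded_direction_in_plane:
  assumes lc: "linearly_closed C"
    and nl: "\<And>v. (\<forall>t. x + t *\<^sub>R v \<in> C) \<Longrightarrow> v = 0"
    and D: "subspace D" "v \<in> D" "w \<in> D" "v \<noteq> 0" "w \<notin> span {v}"
    and all: "\<And>u. u \<in> D \<Longrightarrow> u \<noteq> 0 \<Longrightarrow> (\<forall>t\<ge>0. x + t *\<^sub>R u \<in> C) \<or> (\<forall>t\<ge>0. x - t *\<^sub>R u \<in> C)"
  shows False
proof -
  define rec where "rec = {u. \<forall>t\<ge>0. x + t *\<^sub>R u \<in> C}"
  have cover: "u \<in> rec \<or> - u \<in> rec" if "u \<in> D" "u \<noteq> 0" for u
    using all[OF that] unfolding rec_def by simp
  have disj: "u = 0" if "u \<in> rec" "- u \<in> rec" for u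
  proof (rule nl, rule allI)
    fix t show "x + t *\<^sub>R u \<in> C"
      using that unfolding rec_def by (cases "t \<ge> 0") (auto dest: spec[of _ "- t"])
  qed
  \<comment> \<open>Along a line, the recession directions at \<open>x\<close> form an intersection
    of sections of \<open>C\<close> by lines, so linear closedness is enough.\<close>
  have closed_rec: "closed {t::real. a + t *\<^sub>R b \<in> rec}" for a b
  proof -
    have "{t. a + t *\<^sub>R b \<in> rec} = (\<Inter>s\<in>{0..}. {t. (x + s *\<^sub>R a) + t *\<^sub>R (s *\<^sub>R b) \<in> C})"
      by (auto simp: rec_def algebra_simps)
    moreover have "closed {t. (x + s *\<^sub>R a) + t *\<^sub>R (s *\<^sub>R b) \<in> C}" for s
      using lc unfolding linearly_closed_def by blast
    ultimately show ?thesis by auto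
  qed
  obtain v' w' where vw: "v' \<in> rec" "w' \<in> rec" "v' \<in> D" "w' \<in> D" "v' \<noteq> 0" "w' \<notin> span {v'}"
  proof -
    define v' where "v' = (if v \<in> rec then v else - v)"
    define w' where "w' = (if w \<in> rec then w else - w)"
    have w0: "w \<noteq> 0" using D(5) span_zero by metis
    have sp: "span {v'} = span {v}"
    proof -
      have "- v \<in> span {v}" "v \<in> span {- v}"
        using span_neg[of "v" "{v}"] span_neg[of "- v" "{- v}"] by (simp_all add: span_base)
      then have "span {- v} = span {v}" by (intro span_eq[THEN iffD2]) simp
      then show ?thesis unfolding v'_def by simp
    qed
    have "w' \<notin> span {v}" using D(5) span_neg[of "- w" "{v}"] unfolding w'_def by auto
    then show ?thesis
      using that[of v' w'] cover[OF D(2,4)] cover[OF D(3) w0] D sp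
      unfolding v'_def w'_def by (simp split: if_splits add: subspace_neg)
  qed
  define T1 where "T1 = {t. v' + t *\<^sub>R (- (v' + w')) \<in> rec}"
  define T2 where "T2 = {t. - v' + t *\<^sub>R (v' + w') \<in> rec}"
  have neg: "- (v' + t *\<^sub>R (- (v' + w'))) = - v' + t *\<^sub>R (v' + w')" for t
    by (simp add: algebra_simps)
  \<comment> \<open>The segment runs from \<open>v'\<close> at \<open>t = 0\<close> to
    \<open>- w'\<close> at \<open>t = 1\<close>. Independence keeps it away from 0, the only vector
    that can be a recession direction together with its negative.\<close>
  have nz: "v' + t *\<^sub>R (- (v' + w')) \<noteq> 0" for t
  proof
    assume *: "v' + t *\<^sub>R (- (v' + w')) = 0"
    show False
    proof (cases "t = 0")
      case True then show False using * vw(5) by simp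
    next
      case False
      have "t *\<^sub>R w' = (1 - t) *\<^sub>R v'" using * by (simp add: algebra_simps)
      then have "w' = ((1 - t) / t) *\<^sub>R v'"
        using False by (metis divide_inverse_commute scaleR_scaleR scaleR_one left_inverse)
      then show False using vw(6) by (auto simp: span_singleton)
    qed
  qed
  have inD: "v' + t *\<^sub>R (- (v' + w')) \<in> D" for t
    by (intro subspace_add[OF D(1)] subspace_scale[OF D(1)] subspace_neg[OF D(1)] vw)
  have cov: "{0..1} \<subseteq> T1 \<union> T2"
    using cover[OF inD nz] unfolding T1_def T2_def neg by blast
  have dis: "T1 \<inter> T2 \<inter> {0..1} = {}"
    using disj nz unfolding T1_def T2_def neg[symmetric] by blast
  have clo: "closed T1" "closed T2" unfolding T1_def T2_def by (rule closed_rec)+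
  have ne: "0 \<in> T1" "1 \<in> T2" using vw(1,2) by (simp_all add: T1_def T2_def)
  show False
    using connected_closedD[OF connected_Icc dis cov clo] ne by force
qed

text \<open>Induction on the dimension of the minimal face. If some direction is bounded both ways,
  \<open>x\<close> lies between two exit points with faces of smaller dimension. If none is,
  \<open>bounded_direction_in_plane\<close> leaves at most one dimension, and \<open>x\<close> is
  extreme or on an extreme ray.\<close>

lemma klee_hull:
  assumes C: "convex C" "linearly_closed C"
    and nl: "\<And>x v. (\<forall>t. x + t *\<^sub>R v \<in> C) \<Longrightarrow> v = 0"
    and fd: "findim (facedir x C)" and x: "x \<in> C"
  shows "x \<in> convex hull (face_generators x C)"
  using fd x
proof (induction "dim (facedir x C)" arbitrary: x rule: less_induct)
  case (less x)
  note fd = less.prems(1) and x = less.prems(2)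
  let ?D = "facedir x C"
  note sub = subspace_facedir[OF C(1) x]
  have self: "x - x \<in> ?D" using subspace_0[OF sub] by simp
  show ?case
  proof (cases "\<exists>v\<in>?D. \<not> (\<forall>t\<ge>0. x + t *\<^sub>R v \<in> C) \<and> \<not> (\<forall>t\<ge>0. x - t *\<^sub>R v \<in> C)")
    case True
    then obtain v where v: "v \<in> ?D" "\<not> (\<forall>t\<ge>0. x + t *\<^sub>R v \<in> C)"
      "\<not> (\<forall>t\<ge>0. x + t *\<^sub>R (- v) \<in> C)" by auto
    have step: "\<exists>t>0. x + t *\<^sub>R w \<in> convex hull (face_generators x C)"
      if w: "w \<in> ?D" "\<not> (\<forall>t\<ge>0. x + t *\<^sub>R w \<in> C)" for w
    proof -
      obtain t where t: "t > 0" "x + t *\<^sub>R w \<in> C" "facedir (x + t *\<^sub>R w) C \<subseteq> ?D"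
        "dim (facedir (x + t *\<^sub>R w) C) < dim ?D"
        by (rule exit_point[OF C fd w])
      have "x + t *\<^sub>R w \<in> convex hull (face_generators (x + t *\<^sub>R w) C)"
        by (rule less.hyps[OF t(4) findim_mono[OF t(3) fd] t(2)])
      moreover have "(x + t *\<^sub>R w) - x \<in> ?D" using subspace_scale[OF sub w(1)] by simp
      ultimately show ?thesis
        using hull_mono[OF face_generators_mono[OF C(1) x t(2)]] t(1) by blast
    qed
    obtain s t where st: "s > 0" "t > 0" "x + s *\<^sub>R v \<in> convex hull (face_generators x C)"
      "x + t *\<^sub>R (- v) \<in> convex hull (face_generators x C)"
      using step[OF v(1,2)] step[OF subspace_neg[OF sub v(1)] v(3)] by blast
    \<comment> \<open>The weight at which \<open>x + s v\<close> and \<open>x - t v\<close> balance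
      at \<open>x\<close>.\<close>
    define u where "u = t / (s + t)"
    have u: "0 \<le> u" "u \<le> 1" "u * s = (1 - u) * t" using st(1,2) by (auto simp: u_def field_simps)
    have "(1 - u) *\<^sub>R (x + t *\<^sub>R (- v)) + u *\<^sub>R (x + s *\<^sub>R v) = x + (u * s - (1 - u) * t) *\<^sub>R v"
      by (simp add: algebra_simps)
    also have "\<dots> = x" using u(3) by simp
    finally show ?thesis
      using convex_combination[OF convex_convex_hull st(4,3) u(1,2)] by simp
  next
    case False
    then have all: "(\<forall>t\<ge>0. x + t *\<^sub>R v \<in> C) \<or> (\<forall>t\<ge>0. x - t *\<^sub>R v \<in> C)" if "v \<in> ?D" for v
      using that by blast
    have "extreme_point x C \<or> ray_point x C"
    proof (cases "?D \<subseteq> {0}")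
      case True
      then show ?thesis using extreme_point_facedir[OF C(1) x] by blast
    next
      case False
      then obtain v0 where v0: "v0 \<in> ?D" "v0 \<noteq> 0" by blast
      obtain v where v: "v \<in> ?D" "v \<noteq> 0" "\<forall>t\<ge>0. x + t *\<^sub>R v \<in> C"
      proof (cases "\<forall>t\<ge>0. x + t *\<^sub>R v0 \<in> C")
        case True then show ?thesis using that v0 by blast
      next
        case False
        then have "\<forall>t\<ge>0. x + t *\<^sub>R (- v0) \<in> C" using all[OF v0(1)] by auto
        then show ?thesis using that[of "- v0"] v0 subspace_neg[OF sub] by auto
      qed
      have "?D \<subseteq> span {v}"
      proof (rule subsetI, rule ccontr)
        fix w assume w: "w \<in> ?D" "w \<notin> span {v}"
        show False
          by (rule bounded_direction_in_plane[OF C(2) _ sub v(1) w(1) v(2) w(2)])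
             (use nl all in blast)+
      qed
      then have D: "?D = span {v}" using v(1) sub by (simp add: span_minimal subset_antisym)
      have "\<not> (\<forall>t\<ge>0. x - t *\<^sub>R v \<in> C)"
      proof
        assume *: "\<forall>t\<ge>0. x - t *\<^sub>R v \<in> C"
        have "x + t *\<^sub>R v \<in> C" for t
          using v(3) *[rule_format, of "- t"] by (cases "t \<ge> 0") auto
        then show False using nl v(2) by blast
      qed
      then show ?thesis using line_ray_point[OF C x D v(2,3)] by blast
    qed
    then show ?thesis using x self by (intro hull_inc) (simp add: face_generators_def)
  qed
qed

section \<open>Caratheodory's argument with points of extreme rays\<close>

text \<open>
  The affine dependence is used in the sign for which the total weight of \<open>a0\<close> and \<open>e\<close> does not
  decrease: these two then merge into one point of the ray from \<open>e\<close> through \<open>a0\<close>, which makes up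
  for the extra point \<open>e\<close>.
\<close>

lemma slide_along_ray:
  fixes Y :: "'a::real_vector set"
  assumes Y: "finite Y" "a0 \<notin> Y"
    and l: "\<And>y. y \<in> Y \<Longrightarrow> 0 \<le> l y" "0 < l a0" "sum l Y + l a0 = 1"
    and x: "x = (\<Sum>y\<in>Y. l y *\<^sub>R y) + l a0 *\<^sub>R a0"
    and g: "sum g Y + g a0 + al = 0" "(\<Sum>y\<in>Y. g y *\<^sub>R y) + g a0 *\<^sub>R a0 + al *\<^sub>R e = 0"
    and sgn: "0 \<le> g a0 + al" and neg: "\<exists>y\<in>insert a0 Y. g y < 0"
  obtains r where "0 \<le> r"
    "(g a0 < 0 \<and> r = 0 \<and> x \<in> convex hull (insert (e + r *\<^sub>R (a0 - e)) Y)) \<or>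
     (\<exists>y\<in>Y. x \<in> convex hull (insert (e + r *\<^sub>R (a0 - e)) (Y - {y})))"
proof -
  define N where "N = {y \<in> insert a0 Y. g y < 0}"
  have N: "finite N" "N \<noteq> {}" using Y(1) neg by (auto simp: N_def)
  \<comment> \<open>The longest step along the dependence that keeps the weights on
    \<open>insert a0 Y\<close> nonnegative; the weight of some \<open>z\<close> vanishes
    there.\<close>
  define tau where "tau = Min ((\<lambda>y. l y / (- g y)) ` N)"
  have l0: "0 \<le> l y" if "y \<in> insert a0 Y" for y using that l(1,2) by auto
  have "tau \<in> (\<lambda>y. l y / (- g y)) ` N" unfolding tau_def using N by (intro Min_in) auto
  then obtain z where z: "z \<in> insert a0 Y" "g z < 0" "tau = l z / (- g z)" by (auto simp: N_def)
  have tau0: "0 \<le> tau" using z l0[OF z(1)] by (simp add: divide_nonneg_neg)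
  define l' where "l' y = l y + tau * g y" for y
  have l'z: "l' z = 0" using z(2,3) by (simp add: l'_def)
  have l'0: "0 \<le> l' y" if y: "y \<in> insert a0 Y" for y
  proof (cases "g y < 0")
    case True
    then have "tau \<le> l y / (- g y)" unfolding tau_def using N y by (intro Min_le) (auto simp: N_def)
    then have "tau * (- g y) \<le> l y" using True by (subst (asm) pos_le_divide_eq) auto
    then show ?thesis by (simp add: l'_def)
  next
    case False
    then show ?thesis using l0[OF y] tau0 by (simp add: l'_def)
  qed
  \<comment> \<open>The joint weight of \<open>a0\<close> and \<open>e\<close>. The share
    \<open>tau * al\<close> of \<open>e\<close> may be negative; then \<open>r > 1\<close> below and
    the merged point \<open>b\<close> lies beyond \<open>a0\<close> on the ray.\<close>
  define mu where "mu = l' a0 + tau * al"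
  have "mu = l a0 + tau * (g a0 + al)" by (simp add: mu_def l'_def algebra_simps)
  then have mu: "mu > 0" using l(2) tau0 sgn by (simp add: add_pos_nonneg)
  define r where "r = l' a0 / mu"
  have r0: "0 \<le> r" using mu l'0[of a0] by (simp add: r_def)
  define b where "b = e + r *\<^sub>R (a0 - e)"
  have "mu *\<^sub>R b = mu *\<^sub>R e + (mu * r) *\<^sub>R (a0 - e)" by (simp add: b_def scaleR_add_right)
  also have "mu * r = l' a0" using mu by (simp add: r_def)
  finally have mub: "mu *\<^sub>R b = l' a0 *\<^sub>R a0 + (tau * al) *\<^sub>R e"
    by (simp add: mu_def algebra_simps)
  have sum1: "sum l' Y + mu = 1"
  proof -
    have "sum l' Y + mu = (sum l Y + l a0) + tau * (sum g Y + g a0 + al)"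
      by (simp add: mu_def l'_def sum.distrib sum_distrib_left algebra_simps)
    then show ?thesis using l(3) g(1) by simp
  qed
  have sumx: "(\<Sum>y\<in>Y. l' y *\<^sub>R y) + mu *\<^sub>R b = x"
  proof -
    have "(\<Sum>y\<in>Y. l' y *\<^sub>R y) = (\<Sum>y\<in>Y. l y *\<^sub>R y) + tau *\<^sub>R (\<Sum>y\<in>Y. g y *\<^sub>R y)"
      by (simp add: l'_def scaleR_add_left sum.distrib scaleR_sum_right)
    then have "(\<Sum>y\<in>Y. l' y *\<^sub>R y) + mu *\<^sub>R b =
        x + tau *\<^sub>R ((\<Sum>y\<in>Y. g y *\<^sub>R y) + g a0 *\<^sub>R a0 + al *\<^sub>R e)"
      unfolding mub x by (simp add: l'_def algebra_simps)
    then show ?thesis using g(2) by simp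
  qed
  have hull: "x \<in> convex hull (insert b Z)"
    if Z: "Z \<subseteq> Y" "\<And>y. y \<in> Y - Z \<Longrightarrow> l' y = 0" for Z
  proof -
    have fin: "finite Z" using Z(1) Y(1) finite_subset by blast
    have s1: "sum l' Z + mu = 1" using sum1 sum.mono_neutral_left[OF Y(1) Z(1), of l'] Z(2) by auto
    have s2: "(\<Sum>y\<in>Z. l' y *\<^sub>R y) + mu *\<^sub>R b = x"
      using sumx sum.mono_neutral_left[OF Y(1) Z(1), of "\<lambda>y. l' y *\<^sub>R y"] Z(2) by auto
    have nn: "\<forall>y\<in>Z. 0 \<le> l' y" using l'0 Z(1) by auto
    define H where "H = convex hull (insert b Z)"
    have "b \<in> H" "Z \<subseteq> H" "convex H" unfolding H_def by (auto intro: hull_inc)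
    show ?thesis
    proof (cases "sum l' Z = 0")
      case True
      then have "\<forall>y\<in>Z. l' y = 0" using sum_nonneg_eq_0_iff[OF fin] nn by auto
      then have "x = b" using s1 s2 True by simp
      then show ?thesis using \<open>b \<in> H\<close> H_def by simp
    next
      case False
      define q where "q = sum l' Z"
      have q: "q > 0" "q \<le> 1" using False nn sum_nonneg[of Z l'] s1 mu by (auto simp: q_def)
      have "(\<Sum>y\<in>Z. (l' y / q) *\<^sub>R y) \<in> H"
        using q nn \<open>Z \<subseteq> H\<close>
        by (intro convex_sum[OF fin \<open>convex H\<close>]) (auto simp: q_def simp flip: sum_divide_distrib)
      then have "(1 - q) *\<^sub>R b + q *\<^sub>R (\<Sum>y\<in>Z. (l' y / q) *\<^sub>R y) \<in> H"
        using q by (intro convex_combination[OF \<open>convex H\<close> \<open>b \<in> H\<close>]) auto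
      moreover have "q *\<^sub>R (\<Sum>y\<in>Z. (l' y / q) *\<^sub>R y) = (\<Sum>y\<in>Z. l' y *\<^sub>R y)"
        using q by (simp add: scaleR_sum_right)
      moreover have "1 - q = mu" using s1 q_def by simp
      ultimately show ?thesis using s2 H_def by (simp add: add.commute)
    qed
  qed
  show ?thesis
  proof (rule that[OF r0])
    show "(g a0 < 0 \<and> r = 0 \<and> x \<in> convex hull (insert (e + r *\<^sub>R (a0 - e)) Y)) \<or>
     (\<exists>y\<in>Y. x \<in> convex hull (insert (e + r *\<^sub>R (a0 - e)) (Y - {y})))"
    \<comment> \<open>Either \<open>a0\<close> itself loses its weight and is exchanged for
      \<open>e\<close>, or some other point is dropped while \<open>a0\<close> slides to
      \<open>b\<close>.\<close>
    proof (cases "z = a0")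
      case True
      then have "r = 0" using l'z by (simp add: r_def)
      then show ?thesis using hull[of Y] z(2) True unfolding b_def by blast
    next
      case False
      then have "z \<in> Y" using z(1) by simp
      moreover have "x \<in> convex hull (insert b (Y - {z}))"
        by (rule hull) (use l'z in auto)
      ultimately show ?thesis unfolding b_def by blast
    qed
  qed
qed

text \<open>At \<open>y\<close>, inside its ray, the direction of the ray is two-sided, hence a
  direction of the face of \<open>x\<close>. So sliding along the ray, down to its endpoint, does
  not leave that face.\<close>

lemma ray_pointE:
  assumes C: "convex C" and x: "x \<in> C" and y: "y \<in> C" "y - x \<in> facedir x C" "ray_point y C"
  obtains e where "e \<in> face_generators x C" "extreme_point e C" "e \<noteq> y"
    "\<And>r. 0 \<le> r \<Longrightarrow> e + r *\<^sub>R (y - e) \<in> face_generators x C"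
proof -
  obtain e v t where e: "extreme_point e C" "v \<noteq> 0" "pface {e + t *\<^sub>R v | t. t > 0} C"
    "t > 0" "y = e + t *\<^sub>R v"
    using y(3) unfolding ray_point_def by blast
  note sub = subspace_facedir[OF C x]
  have inC: "e + s *\<^sub>R v \<in> C" if "s > 0" for s using e(3) that unfolding pface_def by blast
  have eC: "e \<in> C" using e(1) unfolding extreme_point_def pface_def by blast
  have "v \<in> facedir y C"
    using inC[of "t + t/2"] inC[of "t - t/2"] e(4)
    unfolding e(5) scaleR_add_left scaleR_diff_left
    by (intro facedirI[of "t/2"]) (simp_all add: add.assoc add_diff_eq)
  then have v: "v \<in> facedir x C" using facedir_subset[OF C y(1,2)] by blast
  have dir: "e + s *\<^sub>R v - x \<in> facedir x C" for s
  proof -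
    have "e + s *\<^sub>R v - x = (y - x) + (s - t) *\<^sub>R v" using e(5) by (simp add: algebra_simps)
    also have "\<dots> \<in> facedir x C" by (rule subspace_add[OF sub y(2) subspace_scale[OF sub v]])
    finally show ?thesis .
  qed
  have eG: "e \<in> face_generators x C"
    using eC dir[of 0] e(1) by (simp add: face_generators_def)
  have "e + r *\<^sub>R (y - e) \<in> face_generators x C" if "0 \<le> r" for r
  proof (cases "r = 0")
    case True then show ?thesis using eG by simp
  next
    case False
    then have rt: "r * t > 0" using that e(4) by simp
    then have "ray_point (e + (r * t) *\<^sub>R v) C" unfolding ray_point_def using e by blast
    then show ?thesis using inC[OF rt] dir[of "r * t"] e(5) by (simp add: face_generators_def)
  qed
  then show ?thesis using that[OF eG e(1)] e by simp
qed

lemma face_generators_affine_dependent: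
  assumes C: "convex C" and x: "x \<in> C" and fd: "findim (facedir x C)"
    and Z: "finite Z" "Z \<subseteq> face_generators x C" "dim (facedir x C) + 2 \<le> card Z"
  shows "affine_dependent Z"
proof -
  note sub = subspace_facedir[OF C x]
  obtain a where a: "a \<in> Z" using Z(3) by fastforce
  obtain B where B: "finite B" "facedir x C \<subseteq> span B" "card B = dim (facedir x C)"
    using findim_basis[OF fd] by metis
  let ?I = "(\<lambda>y. - a + y) ` (Z - {a})"
  have "?I \<subseteq> facedir x C"
  proof (rule image_subsetI)
    fix y assume "y \<in> Z - {a}"
    then have "y - x \<in> facedir x C" "a - x \<in> facedir x C"
      using Z(2) a by (auto simp: face_generators_def)
    then have "(y - x) - (a - x) \<in> facedir x C" by (rule subspace_diff[OF sub])
    then show "- a + y \<in> facedir x C" by simp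
  qed
  moreover have "card ?I = card Z - 1" using a by (simp add: card_image)
  ultimately have "dependent ?I"
    using independent_span_bound[OF B(1), of ?I] B(2,3) Z(3) by fastforce
  then show ?thesis using affine_dependent_iff_dependent2[OF a] by simp
qed

text \<open>Induction on the number of points plus the number of non-extreme ones. If all points are
  extreme, a dependence needs \<open>n + 2\<close> of them, \<open>n\<close> being the dimension of
  the face. If a ray point is present, the endpoint of its ray joins the dependence, so reduction
  continues from \<open>n + 1\<close> points down to \<open>n\<close>.\<close>

lemma caratheodory_generators:
  assumes C: "convex C" and x: "x \<in> C" and fd: "findim (facedir x C)"
    and X: "finite X" "X \<subseteq> face_generators x C" "x \<in> convex hull X"
  shows "(\<exists>X. finite X \<and> card X \<le> dim (facedir x C) + 1 \<and> (\<forall>y\<in>X. extreme_point y C) \<and>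
            x \<in> convex hull X) \<or>
         (\<exists>X. finite X \<and> card X \<le> dim (facedir x C) \<and> X \<subseteq> face_generators x C \<and>
            x \<in> convex hull X)"
  using X
proof (induction "card X + card {y \<in> X. \<not> extreme_point y C}" arbitrary: X rule: less_induct)
  case (less X)
  note fin = less.prems(1) and XG = less.prems(2) and xX = less.prems(3)
  let ?bad = "\<lambda>X. {y \<in> X. \<not> extreme_point y C}"
  let ?n = "dim (facedir x C)"
  show ?case
  proof (cases "card X \<le> ?n \<or> card X \<le> ?n + 1 \<and> ?bad X = {}")
    case True then show ?thesis using less.prems by blast
  next
    case False
    then have big: "?n + 1 \<le> card X" "?bad X = {} \<Longrightarrow> ?n + 2 \<le> card X" by auto
    obtain l where l: "\<And>y. y \<in> X \<Longrightarrow> 0 \<le> l y" "sum l X = 1" "(\<Sum>y\<in>X. l y *\<^sub>R y) = x"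
      using xX unfolding convex_hull_finite[OF fin] by blast
    show ?thesis
    proof (cases "\<exists>y\<in>X. l y = 0")
      case True
      then obtain y where y: "y \<in> X" "l y = 0" by blast
      have "sum l (X - {y}) = 1" "(\<Sum>z\<in>X - {y}. l z *\<^sub>R z) = x"
        using l(2,3) y by (simp_all add: sum_diff1 fin)
      then have "x \<in> convex hull (X - {y})"
        using l(1) fin by (subst convex_hull_finite) auto
      moreover have "card (X - {y}) < card X" using y fin by (meson card_Diff1_less)
      moreover have "card (?bad (X - {y})) \<le> card (?bad X)" using fin by (intro card_mono) auto
      ultimately show ?thesis using less.hyps[of "X - {y}"] fin XG by fastforce
    next
      case False
      then have lpos: "0 < l y" if "y \<in> X" for y using l(1)[OF that] that by (metis less_eq_real_def)
      \<comment> \<open>\<open>a0\<close> is the point to be moved and \<open>e\<close> the endpoint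
        of its ray. When all points are extreme the ray degenerates to \<open>e = a0\<close>, which
        gives the usual reduction.\<close>
      obtain a0 e where a0: "a0 \<in> X" and e: "e \<in> face_generators x C" "extreme_point e C"
        and ray: "\<And>r. 0 \<le> r \<Longrightarrow> e + r *\<^sub>R (a0 - e) \<in> face_generators x C"
        and ea0: "extreme_point a0 C \<Longrightarrow> e = a0" and bad: "\<not> extreme_point a0 C \<or> ?bad X = {}"
      proof (cases "?bad X = {}")
        case True
        then obtain a0 where "a0 \<in> X" using big by fastforce
        then show ?thesis using that[of a0 a0] True XG by (auto simp: face_generators_def)
      next
        case False
        then obtain a0 where a0: "a0 \<in> X" "\<not> extreme_point a0 C" by blast
        then have "a0 \<in> C" "a0 - x \<in> facedir x C" "ray_point a0 C"
          using XG by (auto simp: face_generators_def)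
        from ray_pointE[OF C x this] obtain e where "e \<in> face_generators x C" "extreme_point e C"
          "\<And>r. 0 \<le> r \<Longrightarrow> e + r *\<^sub>R (a0 - e) \<in> face_generators x C" by metis
        then show ?thesis using that[of a0 e] a0 by blast
      qed
      define Y where "Y = X - {a0}"
      have Y: "finite Y" "a0 \<notin> Y" "X = insert a0 Y" using fin a0 by (auto simp: Y_def)
      have cX: "card X = card Y + 1" using Y by simp
      have "\<exists>g al. sum g Y + g a0 + al = 0 \<and>
          (\<Sum>y\<in>Y. g y *\<^sub>R y) + g a0 *\<^sub>R a0 + al *\<^sub>R e = 0 \<and> 0 \<le> g a0 + al \<and>
          (\<exists>y\<in>insert a0 Y. g y < 0) \<and> (e = a0 \<longrightarrow> g a0 = (0::real))"
      proof (cases "e \<in> Y")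
        case True
        \<comment> \<open>If \<open>e\<close> already occurs in \<open>Y\<close>, the trivial
          relation \<open>e - e = 0\<close> serves: weight moves from that occurrence to the one
          merged with \<open>a0\<close>.\<close>
        let ?g = "\<lambda>y. if y = e then - 1 else 0 :: real"
        have "sum ?g Y = - 1" using True Y(1) by simp
        moreover have "(\<Sum>y\<in>Y. ?g y *\<^sub>R y) = - e"
          using True Y(1) by (simp add: if_distrib[of "\<lambda>c. c *\<^sub>R _"] cong: if_cong)
        moreover have "e \<noteq> a0" using True Y(2) by blast
        ultimately show ?thesis using True by (intro exI[of _ ?g] exI[of _ 1]) auto
      next
        case eY: False
        define Z where "Z = insert e X"
        have Zfin: "finite Z" using fin by (simp add: Z_def)
        have ZG: "Z \<subseteq> face_generators x C" using XG e by (simp add: Z_def)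
        have cardZ: "?n + 2 \<le> card Z"
        proof (cases "e = a0")
          case True
          then have "?bad X = {}" using bad e(2) by blast
          then show ?thesis using big(2) True a0 by (simp add: Z_def insert_absorb)
        next
          case False
          then have "e \<notin> X" using eY Y(3) by blast
          then show ?thesis using big(1) fin by (simp add: Z_def)
        qed
        have "affine_dependent Z"
          by (rule face_generators_affine_dependent[OF C x fd Zfin ZG cardZ])
        then obtain U where U: "sum U Z = 0" "\<exists>v\<in>Z. U v \<noteq> 0" "(\<Sum>v\<in>Z. U v *\<^sub>R v) = 0"
          using affine_dependent_explicit_finite[OF Zfin] by blast
        \<comment> \<open>The sign that makes \<open>g a0 + al\<close> nonnegative. The coefficient
          of \<open>e\<close> is carried by \<open>al\<close> alone, so for \<open>a0 = e\<close> it
          must not be counted twice.\<close>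
        define s :: real where "s = (if 0 \<le> (if a0 = e then 0 else U a0) + U e then 1 else - 1)"
        define g where "g y = (if y = e then 0 else s * U y)" for y
        define al where "al = s * U e"
        have s0: "s \<noteq> 0" by (simp add: s_def)
        have Ze: "X - {e} = Z - {e}" "e \<in> Z" by (auto simp: Z_def)
        have sumX: "sum g X = s * sum U (Z - {e})"
        proof -
          have "sum g X = sum g (X - {e})"
            using fin by (intro sum.mono_neutral_right) (auto simp: g_def)
          also have "\<dots> = (\<Sum>y\<in>Z - {e}. s * U y)" unfolding Ze(1) by (rule sum.cong) (auto simp: g_def)
          finally show ?thesis by (simp add: sum_distrib_left)
        qed
        have sumX2: "(\<Sum>y\<in>X. g y *\<^sub>R y) = s *\<^sub>R (\<Sum>y\<in>Z - {e}. U y *\<^sub>R y)"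
        proof -
          have "(\<Sum>y\<in>X. g y *\<^sub>R y) = (\<Sum>y\<in>X - {e}. g y *\<^sub>R y)"
            using fin by (intro sum.mono_neutral_right) (auto simp: g_def)
          also have "\<dots> = (\<Sum>y\<in>Z - {e}. s *\<^sub>R U y *\<^sub>R y)"
            unfolding Ze(1) by (rule sum.cong) (auto simp: g_def)
          finally show ?thesis by (simp add: scaleR_sum_right)
        qed
        have "sum g X + al = s * (sum U (Z - {e}) + U e)"
          unfolding sumX al_def by (simp add: algebra_simps)
        also have "\<dots> = 0" using U(1) sum.remove[OF Zfin Ze(2), of U] by simp
        finally have g1: "sum g X + al = 0" .
        have "(\<Sum>y\<in>X. g y *\<^sub>R y) + al *\<^sub>R e = s *\<^sub>R ((\<Sum>y\<in>Z - {e}. U y *\<^sub>R y) + U e *\<^sub>R e)"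
          unfolding sumX2 al_def by (simp add: algebra_simps)
        also have "\<dots> = 0" using U(3) sum.remove[OF Zfin Ze(2), of "\<lambda>y. U y *\<^sub>R y"] by (simp add: add.commute)
        finally have g2: "(\<Sum>y\<in>X. g y *\<^sub>R y) + al *\<^sub>R e = 0" .
        have r1: "sum g Y + g a0 + al = 0" using g1 Y by (simp add: add.commute)
        have r2: "(\<Sum>y\<in>Y. g y *\<^sub>R y) + g a0 *\<^sub>R a0 + al *\<^sub>R e = 0" using g2 Y by (simp add: add.commute)
        have sgn: "0 \<le> g a0 + al" by (simp add: g_def al_def s_def)
        \<comment> \<open>The negative coefficient must sit on a point of \<open>X\<close>, since
          only those bound the step. Otherwise \<open>sgn\<close> and the zero sum kill
          \<open>g\<close> on \<open>Y\<close>, the relation reduces to a multiple of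
          \<open>a0 - e\<close>, and all of \<open>U\<close> vanishes.\<close>
        have "\<exists>y\<in>insert a0 Y. g y < 0"
        proof (rule ccontr)
          assume "\<not> ?thesis"
          then have nn: "\<And>y. y \<in> insert a0 Y \<Longrightarrow> 0 \<le> g y" by force
          have "sum g Y = 0" using r1 sgn sum_nonneg[of Y g] nn by fastforce
          then have gY: "\<forall>y\<in>Y. g y = 0" using sum_nonneg_eq_0_iff[OF Y(1)] nn by auto
          then have al: "al = - g a0" using r1 by simp
          have "g a0 *\<^sub>R (a0 - e) = 0" using r2 gY al by (simp add: algebra_simps)
          then have ga: "g a0 = 0" by (auto simp: g_def)
          have "U v = 0" if "v \<in> Z" for v
          proof (cases "v = e")
            case True then show ?thesis using al ga s0 by (simp add: al_def)
          next
            case False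
            then have "v \<in> insert a0 Y" using that Y(3) by (simp add: Z_def)
            then have "g v = 0" using gY ga by auto
            then show ?thesis using False s0 by (simp add: g_def)
          qed
          then show False using U(2) by blast
        qed
        then show ?thesis using r1 r2 sgn by (intro exI[of _ g] exI[of _ al]) (auto simp: g_def)
      qed
      then obtain g al where g: "sum g Y + g a0 + al = 0"
          "(\<Sum>y\<in>Y. g y *\<^sub>R y) + g a0 *\<^sub>R a0 + al *\<^sub>R e = 0" "0 \<le> g a0 + al"
          "\<exists>y\<in>insert a0 Y. g y < 0" "e = a0 \<Longrightarrow> g a0 = 0"
        by blast
      have lY: "\<And>y. y \<in> Y \<Longrightarrow> 0 \<le> l y" "0 < l a0" "sum l Y + l a0 = 1"
        "x = (\<Sum>y\<in>Y. l y *\<^sub>R y) + l a0 *\<^sub>R a0"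
        using l lpos Y by (auto simp: add.commute)
      obtain r where r: "0 \<le> r"
        "(g a0 < 0 \<and> r = 0 \<and> x \<in> convex hull (insert (e + r *\<^sub>R (a0 - e)) Y)) \<or>
         (\<exists>y\<in>Y. x \<in> convex hull (insert (e + r *\<^sub>R (a0 - e)) (Y - {y})))"
        by (rule slide_along_ray[OF Y(1,2) lY g(1-4)])
      define b where "b = e + r *\<^sub>R (a0 - e)"
      have bG: "b \<in> face_generators x C" unfolding b_def by (rule ray[OF r(1)])
      have YG: "Y \<subseteq> face_generators x C" using XG Y(3) by blast
      have finbad: "finite (?bad Y)" using Y(1) by simp
      from r(2) show ?thesis
      proof (elim disjE bexE conjE)
        \<comment> \<open>The number of points does not grow, but a ray point has been replaced by
          an extreme one.\<close>
        assume *: "g a0 < 0" "r = 0" "x \<in> convex hull (insert (e + r *\<^sub>R (a0 - e)) Y)"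
        then have a0b: "\<not> extreme_point a0 C" using g(5) ea0 by force
        have "?bad X = insert a0 (?bad Y)" using Y(3) a0b by auto
        moreover have "a0 \<notin> ?bad Y" using Y(2) by blast
        ultimately have "card (?bad X) = card (?bad Y) + 1" using finbad by simp
        moreover have "?bad (insert e Y) = ?bad Y" using e(2) by auto
        moreover have "card (insert e Y) \<le> card X" using Y(1) cX by (simp add: card_insert_if)
        ultimately show ?thesis
          using less.hyps[of "insert e Y"] * Y(1) YG e(1) by fastforce
      next
        fix y assume y: "y \<in> Y" "x \<in> convex hull (insert (e + r *\<^sub>R (a0 - e)) (Y - {y}))"
        \<comment> \<open>\<open>b\<close> can fail to be extreme only if \<open>a0\<close> already
          did, and \<open>a0\<close> is gone.\<close>
        have "card (?bad (insert b (Y - {y}))) \<le> card (?bad X)"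
        proof (cases "extreme_point a0 C")
          case True
          then have "b = a0" using ea0 by (simp add: b_def)
          then show ?thesis using fin Y(3) by (intro card_mono) auto
        next
          case False
          then have "?bad X = insert a0 (?bad Y)" using Y(3) by auto
          moreover have "a0 \<notin> ?bad Y" using Y(2) by blast
          ultimately have "card (?bad X) = card (?bad Y) + 1" using finbad by simp
          moreover have "card (?bad (insert b (Y - {y}))) \<le> card (insert b (?bad Y))"
            using finbad by (intro card_mono) auto
          ultimately show ?thesis using finbad by (simp add: card_insert_if split: if_splits)
        qed
        moreover have "card (insert b (Y - {y})) < card X"
        proof -
          have "card (Y - {y}) < card Y" using y(1) Y(1) by (meson card_Diff1_less)
          then show ?thesis using cX Y(1) by (simp add: card_insert_if)
        qed
        ultimately show ?thesis
          using less.hyps[of "insert b (Y - {y})"] y(2) Y(1) YG bG unfolding b_def by fastforce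
      qed
    qed
  qed
qed

lemma face_bound_facedir:
  assumes C: "convex C" "linearly_closed C"
    and nl: "\<And>x v. (\<forall>t. x + t *\<^sub>R v \<in> C) \<Longrightarrow> v = 0"
    and x: "x \<in> C" and fd: "findim (facedir x C)" and k: "int (dim (facedir x C)) \<le> k"
  shows "face_bound x C k"
  unfolding face_bound_def
proof (intro conjI)
  note sub = subspace_facedir[OF C(1) x]
  let ?F = "{y \<in> C. y - x \<in> facedir x C}"
  let ?d = "{y - z | y z. y \<in> ?F \<and> z \<in> ?F}"
  have d: "?d \<subseteq> facedir x C"
  proof clarify
    fix y z assume "y - x \<in> facedir x C" "z - x \<in> facedir x C"
    then have "(y - x) - (z - x) \<in> facedir x C" by (rule subspace_diff[OF sub])
    then show "y - z \<in> facedir x C" by simp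
  qed
  have "findim ?d" using findim_mono[OF d fd] .
  then obtain B where B: "B \<subseteq> ?d" "finite B" "?d \<subseteq> span B" by (rule findim_basis)
  have "span B = span ?d"
    using span_mono[OF B(1)] span_minimal[OF B(3) subspace_span] by (rule subset_antisym)
  then have "adim_finite ?F" unfolding adim_finite_def using B(2) by blast
  moreover have "int (adim ?F) \<le> k"
    using dim_mono_findim[OF subset_trans[OF d span_superset] fd] k unfolding adim_def by simp
  moreover have "x \<in> ?F" using x subspace_0[OF sub] by simp
  ultimately show "\<exists>F. pface F C \<and> x \<in> F \<and> adim_finite F \<and> int (adim F) \<le> k"
    using pface_facedir[OF C(1) x] by blast
next
  have "x \<in> convex hull (face_generators x C)" by (rule klee_hull[OF C nl fd x])
  then obtain X where X: "finite X" "X \<subseteq> face_generators x C" "x \<in> convex hull X"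
    unfolding convex_hull_explicit[of "face_generators x C"]
    by (auto simp: convex_hull_finite)
  have ray: "extreme_point y C \<or> (\<exists>H. extreme_ray H C \<and> y \<in> H)" if "y \<in> face_generators x C" for y
  proof -
    have "\<exists>H. extreme_ray H C \<and> y \<in> H" if rp: "ray_point y C"
    proof -
      obtain v a t where "v \<noteq> 0" "pface {a + t *\<^sub>R v | t. t > 0} C" "t > 0" "y = a + t *\<^sub>R v"
        using rp unfolding ray_point_def by blast
      moreover from this(2) have "{a + t *\<^sub>R v | t. t > 0} \<subseteq> C" unfolding pface_def by blast
      ultimately show ?thesis unfolding extreme_ray_def by blast
    qed
    then show ?thesis using that by (auto simp: face_generators_def)
  qed
  have kk: "int (card X) \<le> k + 1" if "card X \<le> dim (facedir x C) + 1" for X :: "'a set"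
    using that k by linarith
  have kk': "int (card X) \<le> k" if "card X \<le> dim (facedir x C)" for X :: "'a set"
    using that k by linarith
  from caratheodory_generators[OF C(1) x fd X]
  show "(\<exists>X. finite X \<and> int (card X) \<le> k + 1 \<and> (\<forall>y\<in>X. extreme_point y C) \<and> x \<in> convex hull X) \<or>
      (\<exists>X. finite X \<and> int (card X) \<le> k \<and>
         (\<forall>y\<in>X. extreme_point y C \<or> (\<exists>H. extreme_ray H C \<and> y \<in> H)) \<and> x \<in> convex hull X)"
    by (elim disjE exE conjE) (use ray kk kk' in blast)+
qed

subsection \<open>Quotients by the lineality space\<close>

lemma subspace_lineality: "subspace (lineality C)"
  unfolding subspace_def
proof (intro conjI ballI allI)
  show "0 \<in> lineality C" by (simp add: lineality_def)
next
  fix u v assume uv: "u \<in> lineality C" "v \<in> lineality C"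
  have "x + t *\<^sub>R (u + v) \<in> C" if "x \<in> C" for x t
  proof -
    have "(x + t *\<^sub>R u) + t *\<^sub>R v \<in> C" using uv that unfolding lineality_def by blast
    then show ?thesis by (simp add: algebra_simps)
  qed
  then show "u + v \<in> lineality C" by (simp add: lineality_def)
next
  fix c v assume "v \<in> lineality C"
  then show "c *\<^sub>R v \<in> lineality C" by (simp add: lineality_def)
qed

text \<open>Aim from \<open>x\<close> at ever more distant points of the line.\<close>

lemma lineality_line:
  assumes C: "convex C" "linearly_closed C" and line: "\<And>t::real. a + t *\<^sub>R v \<in> C"
  shows "v \<in> lineality C"
  unfolding lineality_def
proof (intro CollectI ballI allI)
  fix x and t :: real assume x: "x \<in> C"
  \<comment> \<open>The point of weight \<open>s\<close> on the segment from \<open>x\<close> to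
    \<open>a + (t/s) v\<close> moves on one fixed line as \<open>s\<close> tends to 0, with limit
    \<open>x + t v\<close>; closedness on that line is what is used.\<close>
  define T where "T = {s. (x + t *\<^sub>R v) + s *\<^sub>R (a - x) \<in> C}"
  have clo: "closed T" using C(2) unfolding linearly_closed_def T_def by blast
  have inT: "inverse (real (Suc n)) \<in> T" for n
  proof -
    define s where "s = inverse (real (Suc n))"
    have s: "0 < s" "s \<le> 1" unfolding s_def by (simp_all add: field_simps)
    have "(1 - s) *\<^sub>R x + s *\<^sub>R (a + (t / s) *\<^sub>R v) \<in> C"
      using convex_combination[OF C(1) x line] s by simp
    moreover have "(1 - s) *\<^sub>R x + s *\<^sub>R (a + (t / s) *\<^sub>R v) = (x + t *\<^sub>R v) + s *\<^sub>R (a - x)"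
      using s(1) by (simp add: algebra_simps)
    ultimately show ?thesis unfolding T_def s_def by simp
  qed
  have "0 \<in> T" by (rule closed_sequentially[OF clo inT LIMSEQ_inverse_real_of_nat])
  then show "x + t *\<^sub>R v \<in> C" by (simp add: T_def)
qed

context
  fixes q :: "'v::real_vector \<Rightarrow> 'b::real_vector" and C :: "'v set"
  assumes q: "is_quotient_map q (lineality C)"
begin

text \<open>\<open>C\<close> is a union of cosets of its lineality space, so the quotient identifies
  no point of \<open>C\<close> with one outside. This carries sections by lines, and with them face
  directions, back and forth.\<close>

lemma quotient_mem_iff: "q y \<in> q ` C \<longleftrightarrow> y \<in> C"
proof
  assume "q y \<in> q ` C"
  then obtain x where x: "x \<in> C" "q y = q x" by blast
  then have "q (y - x) = 0" using q by (simp add: is_quotient_map_def linear_diff)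
  then have "y - x \<in> lineality C" using q by (auto simp: is_quotient_map_def)
  then have "x + 1 *\<^sub>R (y - x) \<in> C" using x(1) unfolding lineality_def by blast
  then show "y \<in> C" by simp
qed auto

lemma quotient_line_iff: "q a + t *\<^sub>R q v \<in> q ` C \<longleftrightarrow> a + t *\<^sub>R v \<in> C"
  using quotient_mem_iff[of "a + t *\<^sub>R v"] q
  by (simp add: is_quotient_map_def linear_add linear_scale)

lemma quotient_surj: obtains x where "y = q x"
  using q unfolding is_quotient_map_def by (metis surjD)

lemma linearly_closed_quotient:
  assumes "linearly_closed C"
  shows "linearly_closed (q ` C)"
  unfolding linearly_closed_def
proof (intro allI)
  fix a v
  obtain a' v' where "a = q a'" "v = q v'" using quotient_surj by metis
  then show "closed {t. a + t *\<^sub>R v \<in> q ` C}"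
    using assms by (simp add: quotient_line_iff linearly_closed_def)
qed

text \<open>A line in the image lifts to a line in \<open>C\<close>, whose direction belongs to the
  lineality space and is therefore sent to 0.\<close>

lemma lineless_quotient:
  assumes "convex C" "linearly_closed C" "\<forall>t. a + t *\<^sub>R v \<in> q ` C"
  shows "v = 0"
proof -
  obtain a' v' where av: "a = q a'" "v = q v'" using quotient_surj by metis
  then have "a' + t *\<^sub>R v' \<in> C" for t using assms(3) by (simp add: quotient_line_iff)
  then have "v' \<in> lineality C" by (rule lineality_line[OF assms(1,2)])
  then show ?thesis using q av(2) by (auto simp: is_quotient_map_def)
qed

lemma facedir_quotient: "facedir (q x) (q ` C) = q ` facedir x C"
proof -
  have iff: "q v \<in> facedir (q x) (q ` C) \<longleftrightarrow> v \<in> facedir x C" for v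
    using quotient_line_iff[of x _ v] quotient_line_iff[of x "- _" v]
    by (simp add: facedir_def)
  then show ?thesis using quotient_surj by (auto simp: image_iff) metis
qed

end

section \<open>Dimension counts in the quotients\<close>

lemma factor_through_quotient:
  fixes q :: "'v::real_vector \<Rightarrow> 'a::real_vector" and g :: "'v \<Rightarrow> 'c::real_vector"
  assumes q: "is_quotient_map q N" and g: "linear g" "\<And>x. x \<in> N \<Longrightarrow> g x = 0"
  obtains h where "linear h" "\<And>x. h (q x) = g x"
proof -
  have lq: "linear q" and sq: "surj q" and kq: "\<And>x. q x = 0 \<Longrightarrow> x \<in> N"
    using q unfolding is_quotient_map_def by auto
  define h where "h y = g (inv q y)" for y
  have hq: "h (q x) = g x" for x
  proof -
    have "q (inv q (q x) - x) = 0" using surj_f_inv_f[OF sq] linear_diff[OF lq] by simp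
    then have "g (inv q (q x) - x) = 0" using kq g(2) by blast
    then show ?thesis using linear_diff[OF g(1)] by (simp add: h_def)
  qed
  have "linear h"
  proof (rule linearI)
    fix x y obtain a b where "x = q a" "y = q b" using sq by (metis surjD)
    then show "h (x + y) = h x + h y"
      using hq linear_add[OF g(1)] linear_add[OF lq] by metis
  next
    fix c x obtain a where "x = q a" using sq by (metis surjD)
    then show "h (c *\<^sub>R x) = c *\<^sub>R h x"
      using hq linear_scale[OF g(1)] linear_scale[OF lq] by metis
  qed
  then show ?thesis using hq that by blast
qed

lemma dim_quotient_tower:
  fixes \<Phi> :: "'v::real_vector \<Rightarrow> 'e::euclidean_space"
  assumes lin: "linear \<Phi>"
    and q1: "is_quotient_map q1 (K \<inter> {u. \<Phi> u = 0})" and q2: "is_quotient_map q2 K"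
    and K: "subspace K" and D: "subspace D" "K \<subseteq> D" and fd: "findim (q1 ` D)"
  shows "findim (q2 ` D)" "dim (q1 ` D) = dim (q2 ` D) + dim (\<Phi> ` K)"
proof -
  have l1: "linear q1" and l2: "linear q2" and k2: "\<And>x. q2 x = 0 \<longleftrightarrow> x \<in> K"
    and k1: "\<And>x. q1 x = 0 \<longleftrightarrow> x \<in> K \<and> \<Phi> x = 0"
    using q1 q2 unfolding is_quotient_map_def by auto
  obtain g where g: "linear g" "\<And>x. g (q1 x) = q2 x"
    using factor_through_quotient[OF q1 l2] k2 by blast
  obtain h where h: "linear h" "\<And>x. h (q1 x) = \<Phi> x"
    using factor_through_quotient[OF q1 lin] by blast
  have s1: "subspace (q1 ` D)" by (rule linear_subspace_image[OF l1 D(1)])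
  have gi: "g ` q1 ` D = q2 ` D" using g(2) by (simp add: image_image)
  have ker: "{a \<in> q1 ` D. g a = 0} = q1 ` K" using g(2) k2 D(2) by auto
  have fi: "findim (q2 ` D)" using findim_image[OF g(1) fd] gi by simp
  have fK: "findim (q1 ` K)" by (rule findim_mono[OF _ fd]) (use D(2) in blast)
  have "dim (q1 ` D) = dim (q2 ` D) + dim (q1 ` K)"
    using rank_nullity_on[OF g(1) s1] fi fK gi ker by simp
  moreover have "dim (q1 ` K) = dim (h ` q1 ` K)"
    by (rule dim_image_injective(2)[OF h(1) linear_subspace_image[OF l1 K] findim_euclidean])
       (use h(2) k1 in auto)
  moreover have "h ` q1 ` K = \<Phi> ` K" using h(2) by (simp add: image_image)
  ultimately show "findim (q2 ` D)" "dim (q1 ` D) = dim (q2 ` D) + dim (\<Phi> ` K)" using fi by simp_all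
qed

text \<open>\<open>dim_preimage_bound\<close> for the map that \<open>\<Phi>\<close> induces on the
  quotient by \<open>N\<close>. Here \<open>J\<close> stands for the directions of the face of
  minimizers, \<open>B\<close> for those in the range.\<close>

lemma dim_quotient_bound:
  fixes \<Phi> :: "'v::real_vector \<Rightarrow> 'e::euclidean_space"
  assumes lin: "linear \<Phi>" and q1: "is_quotient_map q1 N" and N: "N \<subseteq> {u. \<Phi> u = 0}"
    and D: "subspace D" and B: "subspace B"
    and W: "B \<subseteq> W" "\<Phi> ` D \<subseteq> W" "subspace W"
    and J: "findim J" "\<And>v. v \<in> D \<Longrightarrow> \<Phi> v \<in> B \<Longrightarrow> q1 v \<in> span J"
  shows "findim (q1 ` D)" "dim (q1 ` D) + dim B \<le> dim J + dim W"
proof -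
  have l1: "linear q1" using q1 unfolding is_quotient_map_def by auto
  obtain h where h: "linear h" "\<And>x. h (q1 x) = \<Phi> x"
    using factor_through_quotient[OF q1 lin] N by blast
  have sub: "{a \<in> q1 ` D. h a \<in> B} \<subseteq> span J" using h(2) J(2) by auto
  have im: "h ` q1 ` D \<subseteq> W" using W(2) h(2) by auto
  have "findim (q1 ` D) \<and> dim (q1 ` D) + dim B \<le> dim {a \<in> q1 ` D. h a \<in> B} + dim W"
    by (rule dim_preimage_bound[OF h(1) linear_subspace_image[OF l1 D] B W(1) im W(3)
          findim_mono[OF sub findim_span[OF J(1)]]])
  moreover have "dim {a \<in> q1 ` D. h a \<in> B} \<le> dim J" by (rule dim_mono_findim[OF sub J(1)])
  ultimately show "findim (q1 ` D)" "dim (q1 ` D) + dim B \<le> dim J + dim W" by auto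
qed

text \<open>Rank-nullity for the height coordinate, which is onto because of the vector at height 1.
  This is the dimension that obliqueness adds.\<close>

lemma dim_height_slice:
  fixes A :: "('x::real_vector \<times> real) set"
  assumes A: "subspace A" "findim A" and a: "(a, 1) \<in> A"
  shows "findim {x. (x, 0) \<in> A}" "dim A = dim {x. (x, 0) \<in> A} + 1"
proof -
  define M where "M = {y \<in> A. snd y = 0}"
  have sM: "subspace M" using A(1) unfolding M_def subspace_def by auto
  have fM: "findim M" by (rule findim_mono[OF _ A(2)]) (auto simp: M_def)
  have fst: "fst ` M = {x. (x, 0) \<in> A}" by (force simp: M_def)
  show f: "findim {x. (x, 0) \<in> A}" using findim_image[OF linear_fst fM] fst by simp
  have "c \<in> snd ` A" for c
    using subspace_scale[OF A(1) a, of c] by force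
  then have "snd ` A = UNIV" by blast
  then have "dim (snd ` A) = 1" by simp
  moreover have "dim M = dim (fst ` M)"
    by (rule dim_image_injective(2)[OF linear_fst sM]) (use f fst in \<open>auto simp: M_def prod_eq_iff\<close>)
  ultimately show "dim A = dim {x. (x, 0) \<in> A} + 1"
    using rank_nullity_on[OF linear_snd A(1) findim_euclidean] fM fst unfolding M_def by simp
qed

text \<open>The count takes place in a space of dimension \<open>DIM('e) + 1\<close>, where
  \<open>sep\<close> keeps \<open>(0, -1)\<close> out of the sum \<open>W\<close>, so
  \<open>dim W\<close> is at most \<open>DIM('e)\<close>. Both \<open>A1\<close> and
  \<open>B\<close> exceed their slices at height 0 by one dimension, which accounts for the
  2.\<close>

lemma dim_quotient_bound_oblique:
  fixes \<Phi> :: "'v::real_vector \<Rightarrow> 'e::euclidean_space" and q1 :: "'v \<Rightarrow> 'a::real_vector"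
  assumes lin: "linear \<Phi>" and q1: "is_quotient_map q1 N" and N: "N \<subseteq> {u. \<Phi> u = 0}"
    and A: "subspace A" "(a, 1::real) \<in> A" "\<And>v. v \<in> N \<Longrightarrow> (v, 0) \<in> A"
    and B: "subspace B" "(b, 1) \<in> B"
    and sep: "\<And>v r s. (v, r) \<in> A \<Longrightarrow> (- \<Phi> v, s) \<in> B \<Longrightarrow> r + s \<noteq> - 1"
    and J: "findim J" "\<And>v r. (v, r) \<in> A \<Longrightarrow> (\<Phi> v, r) \<in> B \<Longrightarrow> q1 v \<in> span J"
  shows "findim (q1 ` {v. (v, 0) \<in> A})"
    "dim (q1 ` {v. (v, 0) \<in> A}) + dim {w. (w, 0) \<in> B} + 2 \<le> dim J + DIM('e)"
proof -
  have l1: "linear q1" and k1: "\<And>x. q1 x = 0 \<Longrightarrow> x \<in> N" using q1 unfolding is_quotient_map_def by auto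
  obtain h where h: "linear h" "\<And>x. h (q1 x) = \<Phi> x"
    using factor_through_quotient[OF q1 lin] N by blast
  define Q where "Q x = (q1 (fst x), snd x)" for x :: "'v \<times> real"
  define H where "H x = (h (fst x), snd x)" for x :: "'a \<times> real"
  have linQ: "linear Q" unfolding Q_def
    by (intro linearI) (simp_all add: linear_add[OF l1] linear_scale[OF l1])
  have linH: "linear H" unfolding H_def
    by (intro linearI) (simp_all add: linear_add[OF h(1)] linear_scale[OF h(1)])
  define A1 where "A1 = Q ` A"
  have sA1: "subspace A1" unfolding A1_def by (rule linear_subspace_image[OF linQ A(1)])
  define W where "W = {x + y | x y. x \<in> H ` A1 \<and> y \<in> B}"
  have sW: "subspace W" unfolding W_def
    by (rule subspace_sums[OF linear_subspace_image[OF linH sA1] B(1)])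
  have notW: "(0, - 1) \<notin> W"
  proof
    assume "(0, - 1) \<in> W"
    then obtain v r w s where *: "(v, r) \<in> A" "(w, s) \<in> B" "0 = \<Phi> v + w" "- 1 = r + s"
      unfolding W_def A1_def H_def Q_def using h(2) by auto
    then have "w = - \<Phi> v" by (simp add: eq_neg_iff_add_eq_0 add.commute)
    then show False using sep[OF *(1)] *(2,4) by force
  qed
  have dW: "dim W \<le> DIM('e)" using dim_proper_subspace[OF sW notW] by simp
  \<comment> \<open>\<open>A\<close> contains no vertical direction: rescaled to
    \<open>(0, -1)\<close> it would violate \<open>sep\<close>. Hence on \<open>A2\<close> the first
    component determines the height, and \<open>A2\<close> embeds into
    \<open>span J\<close>.\<close>
  have zr: "r = 0" if "(0, r) \<in> A" for r
  proof (rule ccontr)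
    assume "r \<noteq> 0"
    then have "(0, - 1) \<in> A" using subspace_scale[OF A(1) that, of "- 1 / r"] by simp
    then show False using sep[of 0 "- 1" 0] linear_0[OF lin] subspace_0[OF B(1)]
      by (simp add: zero_prod_def)
  qed
  define A2 where "A2 = {x \<in> A1. H x \<in> B}"
  have sA2: "subspace A2"
    using sA1 B(1) linear_0[OF linH] linear_add[OF linH] linear_scale[OF linH]
    unfolding A2_def subspace_def by auto
  have fstA2: "fst ` A2 \<subseteq> span J" using J(2) h(2) by (auto simp: A2_def A1_def H_def Q_def)
  have inj: "x = 0" if x: "x \<in> A2" "fst x = 0" for x
  proof -
    obtain v r where v: "(v, r) \<in> A" "x = (q1 v, r)" using x(1) by (auto simp: A2_def A1_def Q_def)
    then have "(v, 0) \<in> A" using x(2) k1 A(3) by simp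
    then have "(v, r) - (v, 0) \<in> A" using v(1) by (intro subspace_diff[OF A(1)])
    then have "r = 0" using zr by simp
    then show ?thesis using v x(2) by (simp add: zero_prod_def)
  qed
  have fA2: "findim A2" "dim A2 = dim (fst ` A2)"
    using dim_image_injective[OF linear_fst sA2 findim_mono[OF fstA2 findim_span[OF J(1)]]] inj
    by blast+
  have dA2: "dim A2 \<le> dim J" using fA2(2) dim_mono_findim[OF fstA2 J(1)] by simp
  have BW: "B \<subseteq> W"
  proof
    fix y assume y: "y \<in> B"
    have "0 \<in> H ` A1" using subspace_0[OF linear_subspace_image[OF linH sA1]] .
    then have "0 + y \<in> W" unfolding W_def using y by blast
    then show "y \<in> W" by simp
  qed
  have HW: "H ` A1 \<subseteq> W"
  proof
    fix y assume "y \<in> H ` A1"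
    then have "y + 0 \<in> W" unfolding W_def using subspace_0[OF B(1)] by blast
    then show "y \<in> W" by simp
  qed
  have b1: "findim A1" "dim A1 + dim B \<le> dim A2 + dim W"
    using dim_preimage_bound[OF linH sA1 B(1) BW HW sW] fA2(1) unfolding A2_def by auto
  have slice: "{x. (x, 0) \<in> A1} = q1 ` {v. (v, 0) \<in> A}" by (force simp: A1_def Q_def)
  have "(q1 a, 1) \<in> A1" using A(2) unfolding A1_def Q_def by force
  from dim_height_slice[OF sA1 b1(1) this]
  have s: "findim (q1 ` {v. (v, 0) \<in> A})" "dim A1 = dim (q1 ` {v. (v, 0) \<in> A}) + 1"
    unfolding slice by auto
  have "dim B = dim {w. (w, 0) \<in> B} + 1" by (rule dim_height_slice(2)[OF B(1) findim_euclidean B(2)])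
  then show "findim (q1 ` {v. (v, 0) \<in> A})"
    "dim (q1 ` {v. (v, 0) \<in> A}) + dim {w. (w, 0) \<in> B} + 2 \<le> dim J + DIM('e)"
    using s b1(2) dA2 dW by simp_all
qed

subsection \<open>Minimizers of the composite problem\<close>

lemma ext_convex_combination:
  assumes g: "ext_convex g" and "g a \<le> ereal r" "g b \<le> ereal s" "0 \<le> u" "u \<le> 1"
  shows "g ((1 - u) *\<^sub>R a + u *\<^sub>R b) \<le> ereal ((1 - u) * r + u * s)"
proof -
  have "(1 - u) *\<^sub>R (a, r) + u *\<^sub>R (b, s) \<in> epi g"
    using assms by (intro convex_combination) (auto simp: ext_convex_def epi_def)
  then show ?thesis by (simp add: epi_def)
qed

text \<open>The midpoint of two double steps from \<open>x\<close>. It lets a descent step along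
  \<open>a\<close> be corrected by a step along \<open>- b\<close> while half of the decrease
  survives.\<close>

lemma ext_convex_midpoint:
  assumes "ext_convex g" "g (x + (2 * t) *\<^sub>R a) \<le> ereal r" "g (x - (2 * t) *\<^sub>R b) \<le> ereal s"
  shows "g (x + t *\<^sub>R a - t *\<^sub>R b) \<le> ereal ((r + s) / 2)"
proof -
  have "(1 - 1/2) *\<^sub>R (x + (2 * t) *\<^sub>R a) + (1/2) *\<^sub>R (x - (2 * t) *\<^sub>R b) =
      (1/2 + 1/2) *\<^sub>R x + t *\<^sub>R a - t *\<^sub>R b"
    unfolding scaleR_add_left by (simp add: scaleR_add_right scaleR_diff_right)
  then show ?thesis using ext_convex_combination[OF assms, of "1/2"] by (simp add: field_simps)
qed

lemma convex_sublevel: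
  assumes "ext_convex g"
  shows "convex {u. g u \<le> ereal r}"
proof (rule convexI)
  fix x y and u v :: real
  assume *: "x \<in> {u. g u \<le> ereal r}" "y \<in> {u. g u \<le> ereal r}" "0 \<le> u" "0 \<le> v" "u + v = 1"
  then have uv: "u = 1 - v" "v \<le> 1" by auto
  have "(1 - v) * r + v * r = r" by (simp add: algebra_simps)
  then show "u *\<^sub>R x + v *\<^sub>R y \<in> {u. g u \<le> ereal r}"
    using ext_convex_combination[OF assms, of x r y r v] *(1,2,4) uv(2) unfolding uv(1) by simp
qed

text \<open>Height levels are affine, so an oblique face itself contains a point at another height;
  the difference from \<open>(x, c)\<close> is rescaled to height 1.\<close>

lemma oblique_direction:
  assumes C: "convex C" "(x, c) \<in> C" and ob: "oblique (x, c) C"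
  obtains v where "(v, 1) \<in> facedir (x, c) C"
proof -
  have "\<not> minface (x, c) C \<subseteq> {y. snd y = c}"
  proof
    assume "minface (x, c) C \<subseteq> {y. snd y = c}"
    moreover have "affine {y :: 'a \<times> real. snd y = c}"
      by (simp add: affine_def flip: distrib_right)
    ultimately have "affine hull (minface (x, c) C) \<subseteq> {y. snd y = c}" by (rule hull_minimal)
    then show False using ob by (simp add: oblique_def)
  qed
  then obtain y where y: "y \<in> minface (x, c) C" "snd y \<noteq> c" by blast
  define z where "z = y - (x, c)"
  have z: "z \<in> facedir (x, c) C" unfolding z_def by (rule minface_facedir[OF C y(1)])
  have "snd z \<noteq> 0" using y(2) by (simp add: z_def)
  then have "(1 / snd z) *\<^sub>R z = (fst z /\<^sub>R snd z, 1)" by (simp add: prod_eq_iff divide_inverse)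
  then show ?thesis
    using that subspace_scale[OF subspace_facedir[OF C] z, of "1 / snd z"] by simp
qed

text \<open>This direction of the comparison is the useful one, because the dimension of the face in
  \<open>levf\<close> enters the final bounds with a minus sign.\<close>

lemma adim_minface_le:
  assumes "convex C" "x \<in> C" "findim (facedir x C)"
  shows "adim (minface x C) \<le> dim (facedir x C)"
proof -
  have "y - z \<in> facedir x C" if "y \<in> minface x C" "z \<in> minface x C" for y z
    using subspace_diff[OF subspace_facedir[OF assms(1,2)]
        minface_facedir[OF assms(1,2) that(1)] minface_facedir[OF assms(1,2) that(2)]]
    by simp
  then show ?thesis
    unfolding adim_def by (intro dim_mono_findim[OF _ assms(3)]) (auto intro: span_base)
qed

text \<open>A segment of \<open>S\<close> centred at \<open>p\<close> lies in every face of
  \<open>S\<close> through \<open>p\<close>, so its direction is visible in the image of the minimal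
  face.\<close>

lemma segment_direction_in_minface:
  assumes q: "linear q" and e: "e > 0" "\<And>t. \<bar>t\<bar> \<le> e \<Longrightarrow> p + t *\<^sub>R v \<in> S"
  shows "q v \<in> span {x - y | x y. x \<in> q ` minface p S \<and> y \<in> q ` minface p S}"
proof -
  have "open_segment (p - e *\<^sub>R v) (p + e *\<^sub>R v) \<subseteq> S"
  proof
    fix z assume "z \<in> open_segment (p - e *\<^sub>R v) (p + e *\<^sub>R v)"
    then obtain u where u: "0 < u" "u < 1" "z = (1 - u) *\<^sub>R (p - e *\<^sub>R v) + u *\<^sub>R (p + e *\<^sub>R v)"
      by (auto simp: in_segment)
    have "z = ((1 - u) + u) *\<^sub>R p + (u * e - (1 - u) * e) *\<^sub>R v"
      unfolding u(3) scaleR_add_left scaleR_diff_left scaleR_add_right scaleR_diff_right scaleR_scaleR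
      by (simp add: algebra_simps)
    then have "z = p + (u * e - (1 - u) * e) *\<^sub>R v" by simp
    moreover have "\<bar>u * e - (1 - u) * e\<bar> \<le> e"
    proof -
      have "0 \<le> u * e" "0 \<le> (1 - u) * e" "u * e + (1 - u) * e = e"
        using u e(1) by (auto simp: algebra_simps)
      then show ?thesis by linarith
    qed
    ultimately show "z \<in> S" using e(2) by simp
  qed
  then have "p + (1/2) *\<^sub>R (e *\<^sub>R v) \<in> minface p S" by (rule half_step_in_minface)
  then have "q (p + (1/2) *\<^sub>R (e *\<^sub>R v)) - q p \<in>
      span {x - y | x y. x \<in> q ` minface p S \<and> y \<in> q ` minface p S}"
    using self_in_minface[of p S] by (intro span_base) blast
  moreover have "q (p + (1/2) *\<^sub>R (e *\<^sub>R v)) - q p = (e/2) *\<^sub>R q v"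
    by (simp add: linear_add[OF q] linear_scale[OF q])
  ultimately show ?thesis using e(1) span_scale[of "(e/2) *\<^sub>R q v" _ "2 / e"] by simp
qed

lemma common_segment:
  assumes "convex C" "convex C'" "v \<in> facedir x C" "w \<in> facedir y C'"
  shows "\<exists>e>0. (\<forall>t. \<bar>t\<bar> \<le> e \<longrightarrow> x + t *\<^sub>R v \<in> C) \<and> (\<forall>t. \<bar>t\<bar> \<le> e \<longrightarrow> y + t *\<^sub>R w \<in> C')"
proof -
  obtain d e where "d > 0" "\<And>t. \<bar>t\<bar> \<le> d \<Longrightarrow> x + t *\<^sub>R v \<in> C"
    and "e > 0" "\<And>t. \<bar>t\<bar> \<le> e \<Longrightarrow> y + t *\<^sub>R w \<in> C'"
    using facedir_segment[OF assms(1,3)] facedir_segment[OF assms(2,4)] by metis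
  then show ?thesis by (intro exI[of _ "min d e"]) auto
qed

locale minimizer =
  fixes R :: "'v::real_vector \<Rightarrow> ereal"
    and f :: "'e::euclidean_space \<Rightarrow> ereal"
    and \<Phi> :: "'v \<Rightarrow> 'e"
    and p :: 'v and rp fp :: real
  assumes convR: "ext_convex R" and convf: "ext_convex f" and lin: "linear \<Phi>"
    and rp: "R p = ereal rp" and fp: "f (\<Phi> p) = ereal fp"
    and minim: "\<And>v. R p + f (\<Phi> p) \<le> R v + f (\<Phi> v)"
begin

abbreviation "levR \<equiv> {u. R u \<le> R p}"
abbreviation "levf \<equiv> {w. f w \<le> f (\<Phi> p)}"
abbreviation "D \<equiv> facedir p levR"
abbreviation "B \<equiv> facedir (\<Phi> p) levf"
abbreviation "S \<equiv> {u. \<forall>v. R u + f (\<Phi> u) \<le> R v + f (\<Phi> v)}"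

text \<open>The hypograph of \<open>M - f\<close>, where \<open>M\<close> is the minimal value, in
  the form used by the obliqueness condition; \<open>hyp_iff\<close> turns it into a real upper
  bound on \<open>f\<close>.\<close>

definition hyp :: "('e \<times> real) set" where
  "hyp = {(w, r). ereal r \<le> (R p + f (\<Phi> p)) - f w}"

lemma value_bound: "R u \<le> ereal r \<Longrightarrow> f (\<Phi> u) \<le> ereal s \<Longrightarrow> rp + fp \<le> r + s"
  using minim[of u] add_mono[of "R u" "ereal r" "f (\<Phi> u)" "ereal s"] rp fp
  by (metis ereal_less_eq(3) order_trans plus_ereal.simps(1))

lemma minimizerI:
  assumes "R u \<le> ereal r" "f (\<Phi> u) \<le> ereal s" "r + s \<le> rp + fp"
  shows "u \<in> S"
proof -
  have "R u + f (\<Phi> u) \<le> ereal (r + s)" using add_mono[OF assms(1,2)] by simp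
  also have "\<dots> \<le> R p + f (\<Phi> p)" using assms(3) rp fp by simp
  finally show ?thesis using minim order_trans by blast
qed

lemma convex_levR: "convex levR" and convex_levf: "convex levf"
  using convex_sublevel[OF convR, of rp] convex_sublevel[OF convf, of fp] rp fp by simp_all

lemma p_levR: "p \<in> levR" and p_levf: "\<Phi> p \<in> levf" by simp_all

lemma subD: "subspace D" and subB: "subspace B"
  using subspace_facedir[OF convex_levR p_levR] subspace_facedir[OF convex_levf p_levf] .

lemma hyp_iff: "(w, r) \<in> hyp \<longleftrightarrow> f w \<le> ereal (rp + fp - r)"
  using convf rp fp by (cases "f w") (auto simp: ext_convex_def hyp_def)

lemma convex_hyp: "convex hyp"
proof (rule convexI)
  fix x y and u v :: real
  assume *: "x \<in> hyp" "y \<in> hyp" "0 \<le> u" "0 \<le> v" "u + v = 1"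
  obtain a r b s where xy: "x = (a, r)" "y = (b, s)" by (metis surj_pair)
  have uv: "u = 1 - v" "v \<le> 1" using * by auto
  have "f ((1 - v) *\<^sub>R a + v *\<^sub>R b) \<le> ereal ((1 - v) * (rp + fp - r) + v * (rp + fp - s))"
    using *(1,2) uv *(4) unfolding xy hyp_iff by (intro ext_convex_combination[OF convf])
  also have "(1 - v) * (rp + fp - r) + v * (rp + fp - s) = rp + fp - (u * r + v * s)"
    unfolding uv(1) by (simp add: algebra_simps)
  finally have "(u *\<^sub>R a + v *\<^sub>R b, u * r + v * s) \<in> hyp" unfolding hyp_iff uv(1) .
  then show "u *\<^sub>R x + v *\<^sub>R y \<in> hyp" unfolding xy by simp
qed

text \<open>Were \<open>\<Phi> D + B\<close> the whole space, a descent direction of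
  \<open>R\<close> could be shifted by an element of \<open>D\<close> until its image lies in
  \<open>B\<close>; \<open>R\<close> would fall with \<open>f\<close> not rising, against
  minimality. A descent direction of \<open>f\<close> is treated symmetrically.\<close>

lemma no_common_descent:
  assumes "R p > (INF u. R u) \<or> f (\<Phi> p) > (INF w. f w)"
  obtains x where "x \<notin> {y + w | y w. y \<in> \<Phi> ` D \<and> w \<in> B}"
proof -
  have False if all: "\<And>x. x \<in> {y + w | y w. y \<in> \<Phi> ` D \<and> w \<in> B}"
    using assms
  proof
    assume "R p > (INF u. R u)"
    then obtain u0 where "R u0 < ereal rp" unfolding INF_less_iff rp by blast
    moreover have "R u0 \<noteq> - \<infinity>" using convR by (simp add: ext_convex_def)
    ultimately obtain r0 where r0: "R u0 = ereal r0" "r0 < rp" by (cases "R u0") auto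
    obtain a b where ab: "a \<in> D" "b \<in> B" "\<Phi> (u0 - p) = \<Phi> a + b"
      using all[of "\<Phi> (u0 - p)"] by blast
    obtain e where e: "e > 0" "\<And>t. \<bar>t\<bar> \<le> e \<Longrightarrow> p + t *\<^sub>R a \<in> levR"
      "\<And>t. \<bar>t\<bar> \<le> e \<Longrightarrow> \<Phi> p + t *\<^sub>R b \<in> levf"
      using common_segment[OF convex_levR convex_levf ab(1,2)] by blast
    \<comment> \<open>The bound 1/2 makes \<open>2 t\<close> a convex weight between
      \<open>p\<close> and \<open>u0\<close>; the bound \<open>e/2\<close> keeps the double step
      along \<open>a\<close> within the level set.\<close>
    define t where "t = min (1/2) (e/2)"
    have t: "0 < t" "2 * t \<le> 1" "\<bar>- (2 * t)\<bar> \<le> e" "\<bar>t\<bar> \<le> e" using e(1) by (auto simp: t_def)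
    have "(1 - 2 * t) *\<^sub>R p + (2 * t) *\<^sub>R u0 = p + (2 * t) *\<^sub>R (u0 - p)" by (simp add: algebra_simps)
    then have "R (p + (2 * t) *\<^sub>R (u0 - p)) \<le> ereal ((1 - 2 * t) * rp + 2 * t * r0)"
      using ext_convex_combination[OF convR, of p rp u0 r0 "2 * t"] rp r0 t by simp
    moreover have "R (p - (2 * t) *\<^sub>R a) \<le> ereal rp" using e(2)[OF t(3)] rp by simp
    ultimately have "R (p + t *\<^sub>R (u0 - p) - t *\<^sub>R a) \<le> ereal (((1 - 2 * t) * rp + 2 * t * r0 + rp) / 2)"
      by (rule ext_convex_midpoint[OF convR])
    moreover have "\<Phi> (p + t *\<^sub>R (u0 - p) - t *\<^sub>R a) = \<Phi> p + t *\<^sub>R (\<Phi> (u0 - p) - \<Phi> a)"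
      by (simp add: linear_add[OF lin] linear_diff[OF lin] linear_scale[OF lin] algebra_simps)
    then have "f (\<Phi> (p + t *\<^sub>R (u0 - p) - t *\<^sub>R a)) \<le> ereal fp"
      using e(3)[OF t(4)] fp ab(3) by simp
    ultimately have "rp + fp \<le> ((1 - 2 * t) * rp + 2 * t * r0 + rp) / 2 + fp" by (rule value_bound)
    then have "t * rp \<le> t * r0" by (simp add: field_simps)
    then show False using t(1) r0(2) by simp
  next
    \<comment> \<open>Now the descent step is taken in the range and corrected by
      \<open>- b\<close>. What remains is \<open>t \<Phi> a\<close>, which is realised by moving
      \<open>p\<close> along \<open>a\<close> without raising \<open>R\<close> above its value at
      \<open>p\<close>.\<close>
    assume "f (\<Phi> p) > (INF w. f w)"
    then obtain w0 where "f w0 < ereal fp" unfolding INF_less_iff fp by blast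
    moreover have "f w0 \<noteq> - \<infinity>" using convf by (simp add: ext_convex_def)
    ultimately obtain s0 where s0: "f w0 = ereal s0" "s0 < fp" by (cases "f w0") auto
    obtain a b where ab: "a \<in> D" "b \<in> B" "w0 - \<Phi> p = \<Phi> a + b"
      using all[of "w0 - \<Phi> p"] by blast
    obtain e where e: "e > 0" "\<And>t. \<bar>t\<bar> \<le> e \<Longrightarrow> p + t *\<^sub>R a \<in> levR"
      "\<And>t. \<bar>t\<bar> \<le> e \<Longrightarrow> \<Phi> p + t *\<^sub>R b \<in> levf"
      using common_segment[OF convex_levR convex_levf ab(1,2)] by blast
    define t where "t = min (1/2) (e/2)"
    have t: "0 < t" "2 * t \<le> 1" "\<bar>- (2 * t)\<bar> \<le> e" "\<bar>t\<bar> \<le> e" using e(1) by (auto simp: t_def)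
    have "(1 - 2 * t) *\<^sub>R \<Phi> p + (2 * t) *\<^sub>R w0 = \<Phi> p + (2 * t) *\<^sub>R (w0 - \<Phi> p)" by (simp add: algebra_simps)
    then have "f (\<Phi> p + (2 * t) *\<^sub>R (w0 - \<Phi> p)) \<le> ereal ((1 - 2 * t) * fp + 2 * t * s0)"
      using ext_convex_combination[OF convf, of "\<Phi> p" fp w0 s0 "2 * t"] fp s0 t by simp
    moreover have "f (\<Phi> p - (2 * t) *\<^sub>R b) \<le> ereal fp" using e(3)[OF t(3)] fp by simp
    ultimately have "f (\<Phi> p + t *\<^sub>R (w0 - \<Phi> p) - t *\<^sub>R b) \<le> ereal (((1 - 2 * t) * fp + 2 * t * s0 + fp) / 2)"
      by (rule ext_convex_midpoint[OF convf])
    moreover have "\<Phi> p + t *\<^sub>R (w0 - \<Phi> p) - t *\<^sub>R b = \<Phi> (p + t *\<^sub>R a)"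
      unfolding ab(3) by (simp add: linear_add[OF lin] linear_scale[OF lin] algebra_simps)
    ultimately have "f (\<Phi> (p + t *\<^sub>R a)) \<le> ereal (((1 - 2 * t) * fp + 2 * t * s0 + fp) / 2)" by simp
    moreover have "R (p + t *\<^sub>R a) \<le> ereal rp" using e(2)[OF t(4)] rp by simp
    ultimately have "rp + fp \<le> rp + ((1 - 2 * t) * fp + 2 * t * s0 + fp) / 2"
      using value_bound by blast
    then have "t * fp \<le> t * s0" by (simp add: field_simps)
    then show False using t(1) s0(2) by simp
  qed
  then show ?thesis using that by blast
qed

section \<open>Bounds for the face of the image of p\<close>

context
  fixes q1 :: "'v \<Rightarrow> 'a::real_vector" and q2 :: "'v \<Rightarrow> 'b::real_vector"
  assumes q1: "is_quotient_map q1 (lineality levR \<inter> {u. \<Phi> u = 0})"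
    and q2: "is_quotient_map q2 (lineality levR)"
    and lc: "linearly_closed levR"
    and jfin: "adim_finite (q1 ` minface p S)"
begin

abbreviation "J \<equiv> {x - y | x y. x \<in> q1 ` minface p S \<and> y \<in> q1 ` minface p S}"

lemma findim_J: "findim J"
proof -
  obtain X where "finite X" "span X = span J" using jfin unfolding adim_finite_def by blast
  then show ?thesis unfolding findim_def using span_superset[of J] by blast
qed

lemma lineality_D: "lineality levR \<subseteq> D"
proof
  fix v assume v: "v \<in> lineality levR"
  have "p + t *\<^sub>R v \<in> levR" for t using v p_levR unfolding lineality_def by blast
  from this[of 1] this[of "- 1"] show "v \<in> D" by (intro facedirI[of 1]) auto
qed

lemma face_bound_quotient:
  assumes "findim (q1 ` D)"
    "int (dim (q1 ` D)) - int (dim (\<Phi> ` lineality levR)) \<le> k"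
  shows "face_bound (q2 p) (q2 ` levR) k"
proof (rule face_bound_facedir)
  have l2: "linear q2" using q2 unfolding is_quotient_map_def by blast
  note tower = dim_quotient_tower[OF lin q1 q2 subspace_lineality subD lineality_D assms(1)]
  show "convex (q2 ` levR)" by (rule convex_linear_image[OF l2 convex_levR])
  show "linearly_closed (q2 ` levR)" by (rule linearly_closed_quotient[OF q2 lc])
  show "v = 0" if "\<forall>t. x + t *\<^sub>R v \<in> q2 ` levR" for x v
    by (rule lineless_quotient[OF q2 convex_levR lc that])
  show "q2 p \<in> q2 ` levR" using p_levR by blast
  show "findim (facedir (q2 p) (q2 ` levR))"
    unfolding facedir_quotient[OF q2] by (rule tower(1))
  show "int (dim (facedir (q2 p) (q2 ` levR))) \<le> k"
    unfolding facedir_quotient[OF q2] using tower(2) assms(2) by simp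
qed

lemma adim_levf: "adim (minface (\<Phi> p) levf) \<le> dim B"
  by (rule adim_minface_le[OF convex_levf p_levf findim_euclidean])

lemma face_bound_plain:
  "face_bound (q2 p) (q2 ` levR)
     (int DIM('e) - int (adim (minface (\<Phi> p) levf)) + int (adim (q1 ` minface p S))
       - int (dim (\<Phi> ` lineality levR))
       - (if R p > (INF u. R u) \<or> f (\<Phi> p) > (INF w. f w) then 1 else 0))"
proof -
  define W where "W = {y + w | y w. y \<in> \<Phi> ` D \<and> w \<in> B}"
  have sW: "subspace W" unfolding W_def
    by (rule subspace_sums[OF linear_subspace_image[OF lin subD] subB])
  have BW: "B \<subseteq> W"
  proof
    fix w assume "w \<in> B"
    then have "0 + w \<in> W"
      unfolding W_def using subspace_0[OF linear_subspace_image[OF lin subD]] by blast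
    then show "w \<in> W" by simp
  qed
  have DW: "\<Phi> ` D \<subseteq> W"
  proof
    fix y assume "y \<in> \<Phi> ` D"
    then have "y + 0 \<in> W" unfolding W_def using subspace_0[OF subB] by blast
    then show "y \<in> W" by simp
  qed
  \<comment> \<open>The case distinction in the bound comes from here: the space of combined
    directions is known to be proper only if one of the two values is not minimal.\<close>
  have dW: "int (dim W) \<le> int DIM('e) -
      (if R p > (INF u. R u) \<or> f (\<Phi> p) > (INF w. f w) then 1 else 0)"
  proof (cases "R p > (INF u. R u) \<or> f (\<Phi> p) > (INF w. f w)")
    case True
    then obtain x where "x \<notin> W" using no_common_descent unfolding W_def by metis
    then show ?thesis using dim_proper_subspace[OF sW] True by fastforce
  next
    case False
    then show ?thesis using dim_subset_UNIV[of W] by simp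
  qed
  have l1: "linear q1" using q1 unfolding is_quotient_map_def by blast
  have inJ: "q1 v \<in> span J" if v: "v \<in> D" "\<Phi> v \<in> B" for v
  proof -
    obtain e where e: "e > 0" "\<And>t. \<bar>t\<bar> \<le> e \<Longrightarrow> p + t *\<^sub>R v \<in> levR"
      "\<And>t. \<bar>t\<bar> \<le> e \<Longrightarrow> \<Phi> p + t *\<^sub>R \<Phi> v \<in> levf"
      using common_segment[OF convex_levR convex_levf v] by blast
    have "p + t *\<^sub>R v \<in> S" if "\<bar>t\<bar> \<le> e" for t
      by (rule minimizerI[of _ rp fp])
         (use e(2,3)[OF that] rp fp in \<open>simp_all add: linear_add[OF lin] linear_scale[OF lin]\<close>)
    then show ?thesis by (rule segment_direction_in_minface[OF l1 e(1)])
  qed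
  have "findim (q1 ` D)" "dim (q1 ` D) + dim B \<le> dim J + dim W"
    by (rule dim_quotient_bound[OF lin q1 _ subD subB BW DW sW findim_J inJ]; blast)+
  then show ?thesis
    using dW adim_levf by (intro face_bound_quotient) (simp_all add: adim_def)
qed

lemma face_bound_oblique:
  assumes obR: "oblique (p, rp) (epi R)" and obf: "oblique (\<Phi> p, rp) hyp"
  shows "face_bound (q2 p) (q2 ` levR)
     (int DIM('e) - int (adim (minface (\<Phi> p) levf)) + int (adim (q1 ` minface p S))
       - int (dim (\<Phi> ` lineality levR)) - 2)"
proof -
  have cE: "convex (epi R)" using convR by (simp add: ext_convex_def)
  have pE: "(p, rp) \<in> epi R" using rp by (simp add: epi_def)
  have pH: "(\<Phi> p, rp) \<in> hyp" unfolding hyp_iff using fp by simp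
  define A where "A = facedir (p, rp) (epi R)"
  define B' where "B' = facedir (\<Phi> p, rp) hyp"
  have sA: "subspace A" unfolding A_def by (rule subspace_facedir[OF cE pE])
  have sB': "subspace B'" unfolding B'_def by (rule subspace_facedir[OF convex_hyp pH])
  obtain a where a: "(a, 1) \<in> A" using oblique_direction[OF cE pE obR] unfolding A_def .
  obtain b where b: "(b, 1) \<in> B'" using oblique_direction[OF convex_hyp pH obf] unfolding B'_def .
  \<comment> \<open>Directions of height 0 in the epigraph and the hypograph are the face directions
    of the two level sets.\<close>
  have A0: "{v. (v, 0) \<in> A} = D" unfolding A_def facedir_def using rp by (simp add: epi_def)
  have B0: "{w. (w, 0) \<in> B'} = B"
  proof -
    have lev: "(w, rp) \<in> hyp \<longleftrightarrow> w \<in> levf" for w unfolding hyp_iff fp by simp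
    have "(\<Phi> p, rp) + e *\<^sub>R (w, 0) = (\<Phi> p + e *\<^sub>R w, rp)"
      "(\<Phi> p, rp) - e *\<^sub>R (w, 0) = (\<Phi> p - e *\<^sub>R w, rp)" for e :: real and w by simp_all
    then show ?thesis unfolding B'_def facedir_def by (simp only: lev mem_Collect_eq)
  qed
  have seg: "\<exists>e>0. \<forall>t. \<bar>t\<bar> \<le> e \<longrightarrow>
      R (p + t *\<^sub>R v) \<le> ereal (rp + t * r) \<and> f (\<Phi> p + t *\<^sub>R w) \<le> ereal (fp - t * s)"
    if vw: "(v, r) \<in> A" "(w, s) \<in> B'" for v w r s
  proof -
    from common_segment[OF cE convex_hyp vw[unfolded A_def B'_def]]
    obtain e where e: "e > 0" "\<forall>t. \<bar>t\<bar> \<le> e \<longrightarrow> (p, rp) + t *\<^sub>R (v, r) \<in> epi R"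
      "\<forall>t. \<bar>t\<bar> \<le> e \<longrightarrow> (\<Phi> p, rp) + t *\<^sub>R (w, s) \<in> hyp"
      by (elim exE conjE) (rule that)
    show ?thesis
    proof (intro exI[of _ e] conjI[OF e(1)] allI impI)
      fix t assume t: "\<bar>t\<bar> \<le> e"
      have "(\<Phi> p + t *\<^sub>R w, rp + t * s) \<in> hyp" using e(3) t by simp
      then have "f (\<Phi> p + t *\<^sub>R w) \<le> ereal (rp + fp - (rp + t * s))" unfolding hyp_iff .
      then show "R (p + t *\<^sub>R v) \<le> ereal (rp + t * r) \<and> f (\<Phi> p + t *\<^sub>R w) \<le> ereal (fp - t * s)"
        using e(2) t by (simp add: epi_def)
    qed
  qed
  \<comment> \<open>Along \<open>v\<close>, \<open>R\<close> changes at rate at most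
    \<open>r\<close> and \<open>f\<close> at rate at most \<open>s\<close>; with
    \<open>r + s = -1\<close> the sum would drop below its minimum.\<close>
  have sep: "r + s \<noteq> - 1" if vr: "(v, r) \<in> A" "(- \<Phi> v, s) \<in> B'" for v r s
  proof
    assume rs: "r + s = - 1"
    have "(\<Phi> v, - s) \<in> B'" using subspace_neg[OF sB' vr(2)] by simp
    from seg[OF vr(1) this] obtain e where e: "e > 0"
      "R (p + e *\<^sub>R v) \<le> ereal (rp + e * r)" "f (\<Phi> p + e *\<^sub>R \<Phi> v) \<le> ereal (fp - e * (- s))"
      by (metis abs_of_pos order_refl)
    have "rp + fp \<le> rp + e * r + (fp - e * (- s))"
      by (rule value_bound[OF e(2)]) (use e(3) in \<open>simp add: linear_add[OF lin] linear_scale[OF lin]\<close>)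
    then have "0 \<le> e * (r + s)" by (simp add: algebra_simps)
    then show False using e(1) rs by simp
  qed
  have l1: "linear q1" using q1 unfolding is_quotient_map_def by blast
  \<comment> \<open>With equal heights, the bound on \<open>R\<close> rises exactly as fast as the
    bound on \<open>f\<close> falls, so the whole segment consists of minimizers even where
    \<open>R\<close> and \<open>f\<close> vary.\<close>
  have inJ: "q1 v \<in> span J" if vr: "(v, r) \<in> A" "(\<Phi> v, r) \<in> B'" for v r
  proof -
    from seg[OF vr] obtain e where e: "e > 0" "\<And>t. \<bar>t\<bar> \<le> e \<Longrightarrow>
      R (p + t *\<^sub>R v) \<le> ereal (rp + t * r) \<and> f (\<Phi> p + t *\<^sub>R \<Phi> v) \<le> ereal (fp - t * r)" by blast
    have "p + t *\<^sub>R v \<in> S" if "\<bar>t\<bar> \<le> e" for t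
      by (rule minimizerI[of _ "rp + t * r" "fp - t * r"])
         (use e(2)[OF that] in \<open>simp_all add: linear_add[OF lin] linear_scale[OF lin]\<close>)
    then show ?thesis by (rule segment_direction_in_minface[OF l1 e(1)])
  qed
  have NA: "(v, 0) \<in> A" if "v \<in> lineality levR \<inter> {u. \<Phi> u = 0}" for v
    using that lineality_D A0 by blast
  have "findim (q1 ` {v. (v, 0) \<in> A})"
    "dim (q1 ` {v. (v, 0) \<in> A}) + dim {w. (w, 0) \<in> B'} + 2 \<le> dim J + DIM('e)"
    by (rule dim_quotient_bound_oblique[OF lin q1 _ sA a NA sB' b sep findim_J inJ]; blast)+
  then show ?thesis
    unfolding A0 B0 using adim_levf by (intro face_bound_quotient) (simp_all add: adim_def)
qed

end

end

theorem theorem2: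
  fixes R :: "'v::real_vector \<Rightarrow> ereal"
    and f :: "real^'m \<Rightarrow> ereal"
    and \<Phi> :: "'v \<Rightarrow> real^'m"
    and p :: 'v
    and q1 :: "'v \<Rightarrow> 'a::real_vector"
    and q2 :: "'v \<Rightarrow> 'b::real_vector"
    and j :: nat
  defines "S \<equiv> {u. \<forall>v. R u + f (\<Phi> u) \<le> R v + f (\<Phi> v)}"
    and "levR \<equiv> {u. R u \<le> R p}"
    and "levf \<equiv> {w. f w \<le> f (\<Phi> p)}"
    and "K \<equiv> lineality {u. R u \<le> R p}"
    and "L \<equiv> {u. \<Phi> u = 0}"
  assumes convR: "ext_convex R"
    and convf: "ext_convex f"
    and linPhi: "linear \<Phi>"
    and surjPhi: "surj \<Phi>"
    and pS: "p \<in> S"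
    and fin: "R p + f (\<Phi> p) < \<infinity>"
    and lc: "linearly_closed levR"
    and q1: "is_quotient_map q1 (K \<inter> L)"
    and q2: "is_quotient_map q2 K"
    and jdim: "adim_finite (q1 ` minface p S)" "adim (q1 ` minface p S) = j"
  shows "face_bound (q2 p) (q2 ` levR)
           (int CARD('m) - int (adim (minface (\<Phi> p) levf)) + int j - int (dim (\<Phi> ` K))
             - (if R p > (INF u. R u) \<or> f (\<Phi> p) > (INF w. f w) then 1 else 0))
       \<and> (oblique (p, real_of_ereal (R p)) (epi R) \<and>
          oblique (\<Phi> p, real_of_ereal (R p + f (\<Phi> p)) - real_of_ereal (f (\<Phi> p)))
                  {(w, r). ereal r \<le> (R p + f (\<Phi> p)) - f w}
          \<longrightarrow> face_bound (q2 p) (q2 ` levR)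
                (int CARD('m) - int (adim (minface (\<Phi> p) levf)) + int j - int (dim (\<Phi> ` K)) - 2))"
proof -
  have "R p \<noteq> - \<infinity>" "f (\<Phi> p) \<noteq> - \<infinity>" using convR convf by (simp_all add: ext_convex_def)
  then obtain rp fp where rf: "R p = ereal rp" "f (\<Phi> p) = ereal fp"
    using fin by (cases "R p"; cases "f (\<Phi> p)") auto
  interpret minimizer R f \<Phi> p rp fp
    by (rule minimizer.intro) (use convR convf linPhi rf pS in \<open>auto simp: S_def\<close>)
  note ctx = q1[unfolded K_def L_def] q2[unfolded K_def] lc[unfolded levR_def] jdim(1)[unfolded S_def]
  \<comment> \<open>Since \<open>M - f (\<Phi> p)\<close> equals \<open>R p\<close>, both
    obliqueness conditions refer to points at the same height \<open>rp\<close>.\<close>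
  have "real_of_ereal (R p) = rp" "real_of_ereal (R p + f (\<Phi> p)) - real_of_ereal (f (\<Phi> p)) = rp"
    using rf by simp_all
  then show ?thesis
    using face_bound_plain[OF ctx] face_bound_oblique[OF ctx] jdim(2)
    unfolding S_def levR_def levf_def K_def hyp_def by simp
qed

end
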